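(* Let $\Lambda$ be a $k$-graph, and let $\alpha$ be an automorphism of $\Lambda$. Then there is an exact sequence $$0\to H_{k+1}(\Lambda\times_\alpha\mathbb{Z})\xrightarrow{\pi_*}H_k(\Lambda)\xrightarrow{1-\alpha_*}H_k(\Lambda)\xrightarrow{\iota_*}H_k(\Lambda\times_\alpha\mathbb{Z})\to\cdots$$ $$\cdots\to H_1(\Lambda\times_\alpha\mathbb{Z})\xrightarrow{\pi_*}H_0(\Lambda)\xrightarrow{1-\alpha_*}H_0(\Lambda)\xrightarrow{\iota_*}H_0(\Lambda\times_\alpha\mathbb{Z})\to0.$$
   Context: Conventions: $0\in\mathbb{N}$ and $\mathbb{N}^0=\{0\}$. A $k$-graph ($k\ge0$) is a nonempty countable small category $\Lambda$ with a functor $d:\Lambda\to\mathbb{N}^k$ (the degree) satisfying the factorisation property: whenever $d(\lambda)=m+n$ there are unique $\mu,\nu\in\Lambda$ with $d(\mu)=m$, $d(\nu)=n$, $\lambda=\mu\nu$. Objects are identified with identity morphisms; $\Lambda^n=d^{-1}(n)$; $r,s:\Lambda\to\Lambda^0$ are the codomain and domain maps, and $\mu\nu$ is defined when $s(\mu)=r(\nu)$. $e_1,\dots,e_k$ are the standard generators of $\mathbb{N}^k$, $\mathbf{1}_k=\sum_i e_i$, $\le$ on $\mathbb{N}^k$ is coordinatewise, $|n|=\sum_i n_i$. Automorphisms are degree-preserving invertible functors. Homology: $Q_r(\Lambda)=\{\lambda\in\Lambda: d(\lambda)\le\mathbf{1}_k,\ |d(\lambda)|=r\}$. For $\lambda\in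 Q_r(\Lambda)$ with $d(\lambda)=e_{i_1}+\dots+e_{i_r}$, $i_1<\dots<i_r$, and $1\le j\le r$, the faces $F_j^0(\lambda),F_j^1(\lambda)\in Q_{r-1}(\Lambda)$ are the unique elements for which there are $\alpha,\beta\in\Lambda^{e_{i_j}}$ with $F_j^0(\lambda)\beta=\lambda=\alpha F_j^1(\lambda)$. $C_r(\Lambda)=\mathbb{Z}Q_r(\Lambda)$ is the free abelian group on $Q_r(\Lambda)$; for $r\ge1$, $\partial_r:C_r(\Lambda)\to C_{r-1}(\Lambda)$ is the homomorphism with $\partial_r(\lambda)=\sum_{\ell=0}^1\sum_{i=1}^r(-1)^{i+\ell}F_i^\ell(\lambda)$, and $\partial_0=0$. This is a chain complex and $H_r(\Lambda)=\ker\partial_r/\operatorname{Im}\partial_{r+1}$. $\alpha_*$ is the map on $H_r(\Lambda)$ induced by $\lambda\mapsto\alpha(\lambda)$. $\Lambda\times_\alpha\mathbb{Z}$ is the $(k+1)$-graph with morphisms $\Lambda\times\mathbb{N}$, $r(\lambda,n)=(r(\lambda),0)$, $s(\lambda,n)=(\alpha^{-n}(s(\lambda)),0)$, $d(\lambda,n)=(d(\lambda),n)$ and $(\lambda,m)(\mu,n)=(\lambda\alpha^m(\mu),m+n)$. Its cubes are $Q_{r+1}(\Lambda\times_\alpha\mathbb{Z})=(Q_{r+1}(\Lambda)\times\{0\})\sqcup(Q_r(\Lambda)\times\{1\})$ for $r\ge 0$ and $Q_0(\Lambda\times_\alpha\mathbb{Z})=\Lambda^0\times\{0\}$. For $a=\sum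 a_\lambda\lambda$ write $(a,j)=\sum a_\lambda(\lambda,j)$, $j\in\{0,1\}$. The map $\iota_*:H_r(\Lambda)\to H_r(\Lambda\times_\alpha\mathbb{Z})$ is $[a]\mapsto[(a,0)]$, and $\pi_*:H_{r+1}(\Lambda\times_\alpha\mathbb{Z})\to H_r(\Lambda)$ is $[(a,0)+(b,1)]\mapsto(-1)^r[b]$ for $a\in C_{r+1}(\Lambda)$, $b\in C_r(\Lambda)$. *)

theory Defs
  imports "HOL-Algebra.Free_Abelian_Groups" "HOL-Library.Function_Algebras"
begin

section \<open>Higher-rank graphs\<close>

text \<open>
  Elements of \<open>\<nat>\<^sup>k\<close> are functions \<open>nat \<Rightarrow> nat\<close> vanishing outside \<open>{1..k}\<close>, so that \<open>\<nat>\<^sup>0 = {0}\<close>.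
  Sum, zero and order are the pointwise ones on functions.
\<close>

definition Nk :: "nat \<Rightarrow> (nat \<Rightarrow> nat) set" where
  "Nk k = {n. \<forall>i. i \<notin> {1..k} \<longrightarrow> n i = 0}"

definition gen :: "nat \<Rightarrow> nat \<Rightarrow> nat" where
  "gen i = (\<lambda>j. if j = i then 1 else 0)"

definition ones :: "nat \<Rightarrow> nat \<Rightarrow> nat" where
  "ones k = (\<Sum>i=1..k. gen i)"

text \<open>
  Objects are identified with their identity morphisms, so the codomain map \<open>rg\<close> and the domain
  map \<open>src\<close> take values in the set of arrows. The product \<open>\<mu> \<cdot> \<nu>\<close> is meaningful only if
  \<open>src \<mu> = rg \<nu>\<close>.
\<close>

record 'a kgraph_data =
  arrows :: "'a set"
  rg :: "'a \<Rightarrow> 'a"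
  src :: "'a \<Rightarrow> 'a"
  cmp :: "'a \<Rightarrow> 'a \<Rightarrow> 'a"  (infixl \<open>\<cdot>\<index>\<close> 70)
  dg :: "'a \<Rightarrow> nat \<Rightarrow> nat"

locale k_graph =
  fixes k :: nat and \<Lambda> :: "'a kgraph_data" (structure)
  assumes nonempty: "arrows \<Lambda> \<noteq> {}"
    and countable: "countable (arrows \<Lambda>)"
    and rg_arrow: "\<xi> \<in> arrows \<Lambda> \<Longrightarrow> rg \<Lambda> \<xi> \<in> arrows \<Lambda>"
    and src_arrow: "\<xi> \<in> arrows \<Lambda> \<Longrightarrow> src \<Lambda> \<xi> \<in> arrows \<Lambda>"
    and rg_rg: "\<xi> \<in> arrows \<Lambda> \<Longrightarrow> rg \<Lambda> (rg \<Lambda> \<xi>) = rg \<Lambda> \<xi>"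
    and src_rg: "\<xi> \<in> arrows \<Lambda> \<Longrightarrow> src \<Lambda> (rg \<Lambda> \<xi>) = rg \<Lambda> \<xi>"
    and rg_src: "\<xi> \<in> arrows \<Lambda> \<Longrightarrow> rg \<Lambda> (src \<Lambda> \<xi>) = src \<Lambda> \<xi>"
    and src_src: "\<xi> \<in> arrows \<Lambda> \<Longrightarrow> src \<Lambda> (src \<Lambda> \<xi>) = src \<Lambda> \<xi>"
    and cmp_arrow: "\<lbrakk>\<mu> \<in> arrows \<Lambda>; \<nu> \<in> arrows \<Lambda>; src \<Lambda> \<mu> = rg \<Lambda> \<nu>\<rbrakk> \<Longrightarrow> \<mu> \<cdot> \<nu> \<in> arrows \<Lambda>"
    and rg_cmp: "\<lbrakk>\<mu> \<in> arrows \<Lambda>; \<nu> \<in> arrows \<Lambda>; src \<Lambda> \<mu> = rg \<Lambda> \<nu>\<rbrakk> \<Longrightarrow> rg \<Lambda> (\<mu> \<cdot> \<nu>) = rg \<Lambda> \<mu>"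
    and src_cmp: "\<lbrakk>\<mu> \<in> arrows \<Lambda>; \<nu> \<in> arrows \<Lambda>; src \<Lambda> \<mu> = rg \<Lambda> \<nu>\<rbrakk> \<Longrightarrow> src \<Lambda> (\<mu> \<cdot> \<nu>) = src \<Lambda> \<nu>"
    and cmp_id_left: "\<xi> \<in> arrows \<Lambda> \<Longrightarrow> rg \<Lambda> \<xi> \<cdot> \<xi> = \<xi>"
    and cmp_id_right: "\<xi> \<in> arrows \<Lambda> \<Longrightarrow> \<xi> \<cdot> src \<Lambda> \<xi> = \<xi>"
    and cmp_assoc: "\<lbrakk>\<xi> \<in> arrows \<Lambda>; \<mu> \<in> arrows \<Lambda>; \<nu> \<in> arrows \<Lambda>; src \<Lambda> \<xi> = rg \<Lambda> \<mu>; src \<Lambda> \<mu> = rg \<Lambda> \<nu>\<rbrakk>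
          \<Longrightarrow> (\<xi> \<cdot> \<mu>) \<cdot> \<nu> = \<xi> \<cdot> (\<mu> \<cdot> \<nu>)"
    and dg_Nk: "\<xi> \<in> arrows \<Lambda> \<Longrightarrow> dg \<Lambda> \<xi> \<in> Nk k"
    and dg_rg: "\<xi> \<in> arrows \<Lambda> \<Longrightarrow> dg \<Lambda> (rg \<Lambda> \<xi>) = 0"
    and dg_src: "\<xi> \<in> arrows \<Lambda> \<Longrightarrow> dg \<Lambda> (src \<Lambda> \<xi>) = 0"
    and dg_cmp: "\<lbrakk>\<mu> \<in> arrows \<Lambda>; \<nu> \<in> arrows \<Lambda>; src \<Lambda> \<mu> = rg \<Lambda> \<nu>\<rbrakk> \<Longrightarrow> dg \<Lambda> (\<mu> \<cdot> \<nu>) = dg \<Lambda> \<mu> + dg \<Lambda> \<nu>"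
    and factorisation: "\<lbrakk>\<xi> \<in> arrows \<Lambda>; m \<in> Nk k; n \<in> Nk k; dg \<Lambda> \<xi> = m + n\<rbrakk>
          \<Longrightarrow> \<exists>!(\<mu>, \<nu>). \<mu> \<in> arrows \<Lambda> \<and> \<nu> \<in> arrows \<Lambda> \<and> dg \<Lambda> \<mu> = m \<and> dg \<Lambda> \<nu> = n
                \<and> src \<Lambda> \<mu> = rg \<Lambda> \<nu> \<and> \<xi> = \<mu> \<cdot> \<nu>"

definition degree_functor :: "'a kgraph_data \<Rightarrow> ('a \<Rightarrow> 'a) \<Rightarrow> bool" where
  "degree_functor \<Lambda> \<phi> \<longleftrightarrow>
     (\<forall>\<xi>\<in>arrows \<Lambda>. \<phi> \<xi> \<in> arrows \<Lambda> \<and> dg \<Lambda> (\<phi> \<xi>) = dg \<Lambda> \<xi>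
        \<and> rg \<Lambda> (\<phi> \<xi>) = \<phi> (rg \<Lambda> \<xi>) \<and> src \<Lambda> (\<phi> \<xi>) = \<phi> (src \<Lambda> \<xi>))
   \<and> (\<forall>\<mu>\<in>arrows \<Lambda>. \<forall>\<nu>\<in>arrows \<Lambda>. src \<Lambda> \<mu> = rg \<Lambda> \<nu> \<longrightarrow>
        \<phi> (\<mu> \<cdot>\<^bsub>\<Lambda>\<^esub> \<nu>) = \<phi> \<mu> \<cdot>\<^bsub>\<Lambda>\<^esub> \<phi> \<nu>)"

definition kgraph_automorphism :: "'a kgraph_data \<Rightarrow> ('a \<Rightarrow> 'a) \<Rightarrow> bool" where
  "kgraph_automorphism \<Lambda> \<alpha> \<longleftrightarrow> degree_functor \<Lambda> \<alpha> \<and>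
     (\<exists>\<beta>. degree_functor \<Lambda> \<beta> \<and> (\<forall>\<xi>\<in>arrows \<Lambda>. \<beta> (\<alpha> \<xi>) = \<xi> \<and> \<alpha> (\<beta> \<xi>) = \<xi>))"

text \<open>The \<open>(k+1)\<close>-graph \<open>\<Lambda> \<times>\<^sub>\<alpha> \<int>\<close>; the new degree coordinate has index \<open>k + 1\<close>.\<close>

definition crossed_product :: "nat \<Rightarrow> 'a kgraph_data \<Rightarrow> ('a \<Rightarrow> 'a) \<Rightarrow> ('a \<times> nat) kgraph_data" where
  "crossed_product k \<Lambda> \<alpha> =
     \<lparr>arrows = arrows \<Lambda> \<times> UNIV,
      rg = (\<lambda>(\<xi>, n). (rg \<Lambda> \<xi>, 0)),
      src = (\<lambda>(\<xi>, n). ((inv_into (arrows \<Lambda>) \<alpha> ^^ n) (src \<Lambda> \<xi>), 0)),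
      cmp = (\<lambda>(\<xi>, m) (\<mu>, n). (\<xi> \<cdot>\<^bsub>\<Lambda>\<^esub> (\<alpha> ^^ m) \<mu>, m + n)),
      dg = (\<lambda>(\<xi>, n). (dg \<Lambda> \<xi>)(Suc k := n))\<rparr>"

lemma degree_functor_funpow:
  assumes "degree_functor \<Lambda> \<phi>"
  shows "degree_functor \<Lambda> (\<phi> ^^ n)"
proof (induction n)
  case 0
  then show ?case by (simp add: degree_functor_def)
next
  case (Suc n)
  then show ?case using assms by (simp add: degree_functor_def)
qed

lemma automorphism_inv:
  assumes "kgraph_automorphism \<Lambda> \<alpha>"
  defines "\<beta> \<equiv> inv_into (arrows \<Lambda>) \<alpha>"
  assumes G: "k_graph k \<Lambda>"
  shows "degree_functor \<Lambda> \<beta>" "\<And>x. x \<in> arrows \<Lambda> \<Longrightarrow> \<beta> (\<alpha> x) = x" "\<And>x. x \<in> arrows \<Lambda> \<Longrightarrow> \<alpha> (\<beta> x) = x"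
proof -
  obtain \<gamma> where g: "degree_functor \<Lambda> \<gamma>" "\<forall>x\<in>arrows \<Lambda>. \<gamma> (\<alpha> x) = x \<and> \<alpha> (\<gamma> x) = x"
    and a: "degree_functor \<Lambda> \<alpha>"
    using assms unfolding kgraph_automorphism_def by auto
  have inj: "inj_on \<alpha> (arrows \<Lambda>)" using g(2) by (metis inj_onI)
  have eq: "\<beta> x = \<gamma> x" if "x \<in> arrows \<Lambda>" for x
    unfolding \<beta>_def by (rule inv_into_f_eq) (use inj g that in \<open>auto simp: degree_functor_def\<close>)
  show "degree_functor \<Lambda> \<beta>"
    using g(1) G unfolding degree_functor_def by (simp add: eq k_graph.rg_arrow[OF G] k_graph.src_arrow[OF G] k_graph.cmp_arrow[OF G])
  show "\<beta> (\<alpha> x) = x" "\<alpha> (\<beta> x) = x" if "x \<in> arrows \<Lambda>" for x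
    using that g a eq by (auto simp: degree_functor_def)
qed

lemma funpow_inverse:
  assumes "degree_functor \<Lambda> \<phi>" "degree_functor \<Lambda> \<psi>" "\<And>x. x \<in> arrows \<Lambda> \<Longrightarrow> \<phi> (\<psi> x) = x" "x \<in> arrows \<Lambda>"
  shows "(\<phi> ^^ n) ((\<psi> ^^ n) x) = x"
  using assms(4)
proof (induction n arbitrary: x)
  case (Suc n)
  have "(\<psi> ^^ n) x \<in> arrows \<Lambda>" using degree_functor_funpow[OF assms(2)] Suc.prems by (auto simp: degree_functor_def)
  then have "(\<phi> ^^ n) (\<phi> (\<psi> ((\<psi> ^^ n) x))) = x" using assms(3) Suc by simp
  then show ?case by (simp add: funpow_swap1)
qed simp

lemma k_graph_crossed_product:
  assumes G: "k_graph k \<Lambda>" and A: "kgraph_automorphism \<Lambda> \<alpha>"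
  shows "k_graph (k + 1) (crossed_product k \<Lambda> \<alpha>)"
proof -
  interpret k_graph k \<Lambda> by (rule G)
  define \<beta> where "\<beta> = inv_into (arrows \<Lambda>) \<alpha>"
  note inv = automorphism_inv[OF A G, folded \<beta>_def]
  have a: "degree_functor \<Lambda> \<alpha>" using A by (simp add: kgraph_automorphism_def)
  note an = degree_functor_funpow[OF a] and bn = degree_functor_funpow[OF inv(1)]
  have [simp]: "(\<beta> ^^ n) ((\<alpha> ^^ n) x) = x" "(\<alpha> ^^ n) ((\<beta> ^^ n) x) = x" if "x \<in> arrows \<Lambda>" for x n
    using funpow_inverse[OF inv(1) a] funpow_inverse[OF a inv(1)] inv that by auto
  have [simp]: "(\<alpha> ^^ n) x \<in> arrows \<Lambda>" "(\<beta> ^^ n) x \<in> arrows \<Lambda>"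
     "dg \<Lambda> ((\<alpha> ^^ n) x) = dg \<Lambda> x" "dg \<Lambda> ((\<beta> ^^ n) x) = dg \<Lambda> x"
     "src \<Lambda> ((\<alpha> ^^ n) x) = (\<alpha> ^^ n) (src \<Lambda> x)" "src \<Lambda> ((\<beta> ^^ n) x) = (\<beta> ^^ n) (src \<Lambda> x)"
     "rg \<Lambda> ((\<alpha> ^^ n) x) = (\<alpha> ^^ n) (rg \<Lambda> x)" "rg \<Lambda> ((\<beta> ^^ n) x) = (\<beta> ^^ n) (rg \<Lambda> x)"
     if "x \<in> arrows \<Lambda>" for x n using an bn that by (auto simp: degree_functor_def)
  have acmp: "(\<alpha> ^^ n) (x \<cdot>\<^bsub>\<Lambda>\<^esub> y) = (\<alpha> ^^ n) x \<cdot>\<^bsub>\<Lambda>\<^esub> (\<alpha> ^^ n) y"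
    if "x \<in> arrows \<Lambda>" "y \<in> arrows \<Lambda>" "src \<Lambda> x = rg \<Lambda> y" for x y n
    using an that by (auto simp: degree_functor_def)
  have comp: "src \<Lambda> x = (\<alpha> ^^ m) (rg \<Lambda> y)"
    if "x \<in> arrows \<Lambda>" "y \<in> arrows \<Lambda>" "(\<beta> ^^ m) (src \<Lambda> x) = rg \<Lambda> y" for x y m
    using that src_arrow by (metis \<open>\<And>x n. x \<in> arrows \<Lambda> \<Longrightarrow> (\<alpha> ^^ n) ((\<beta> ^^ n) x) = x\<close>)
  note [simp] = rg_arrow src_arrow rg_rg src_rg rg_src src_src cmp_arrow rg_cmp src_cmp cmp_id_left cmp_id_right dg_rg dg_src
  have upd: "dg \<Lambda> x (Suc k) = 0" if "x \<in> arrows \<Lambda>" for x using dg_Nk[OF that] by (simp add: Nk_def)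
  let ?X = "crossed_product k \<Lambda> \<alpha>"
  have X: "arrows ?X = arrows \<Lambda> \<times> UNIV" "rg ?X = (\<lambda>(x, n). (rg \<Lambda> x, 0))"
    "src ?X = (\<lambda>(x, n). ((\<beta> ^^ n) (src \<Lambda> x), 0))" "cmp ?X = (\<lambda>(x, m) (y, n). (x \<cdot>\<^bsub>\<Lambda>\<^esub> (\<alpha> ^^ m) y, m + n))"
    "dg ?X = (\<lambda>(x, n). (dg \<Lambda> x)(Suc k := n))"
    by (simp_all add: crossed_product_def \<beta>_def)
  show ?thesis
  proof
    show "arrows ?X \<noteq> {}" "countable (arrows ?X)" using nonempty countable by (auto simp: X)
  next
    fix l assume "l \<in> arrows ?X"
    then show "rg ?X l \<in> arrows ?X" "src ?X l \<in> arrows ?X"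
      "rg ?X (rg ?X l) = rg ?X l" "src ?X (rg ?X l) = rg ?X l" "rg ?X (src ?X l) = src ?X l" "src ?X (src ?X l) = src ?X l"
      "rg ?X l \<cdot>\<^bsub>?X\<^esub> l = l" "l \<cdot>\<^bsub>?X\<^esub> src ?X l = l"
      "dg ?X (rg ?X l) = 0" "dg ?X (src ?X l) = 0"
      by (auto simp: X fun_eq_iff)
    show "dg ?X l \<in> Nk (k+1)" using dg_Nk \<open>l \<in> arrows ?X\<close> by (auto simp: X Nk_def)
  next
    fix l m assume h: "l \<in> arrows ?X" "m \<in> arrows ?X" "src ?X l = rg ?X m"
    then obtain x i y j where lm: "l = (x,i)" "m = (y,j)" "x \<in> arrows \<Lambda>" "y \<in> arrows \<Lambda>" "(\<beta> ^^ i) (src \<Lambda> x) = rg \<Lambda> y"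
      by (cases l; cases m) (auto simp: X)
    have c: "src \<Lambda> x = (\<alpha> ^^ i) (rg \<Lambda> y)" using comp lm by blast
    show "l \<cdot>\<^bsub>?X\<^esub> m \<in> arrows ?X" "rg ?X (l \<cdot>\<^bsub>?X\<^esub> m) = rg ?X l" 
       using lm c by (auto simp: X)
    have "(\<beta> ^^ (i+j)) ((\<alpha> ^^ i) (src \<Lambda> y)) = (\<beta> ^^ j) (src \<Lambda> y)"
      using lm by (subst add.commute) (simp add: funpow_add)
    then show "src ?X (l \<cdot>\<^bsub>?X\<^esub> m) = src ?X m" using lm c by (auto simp: X)
    show "dg ?X (l \<cdot>\<^bsub>?X\<^esub> m) = dg ?X l + dg ?X m" using lm c by (auto simp: X fun_eq_iff dg_cmp)
  next
    fix l m n assume h: "l \<in> arrows ?X" "m \<in> arrows ?X" "n \<in> arrows ?X" "src ?X l = rg ?X m" "src ?X m = rg ?X n"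
    then obtain x i y j z p where lm: "l = (x,i)" "m = (y,j)" "n = (z,p)" "x \<in> arrows \<Lambda>" "y \<in> arrows \<Lambda>" "z \<in> arrows \<Lambda>"
       "(\<beta> ^^ i) (src \<Lambda> x) = rg \<Lambda> y" "(\<beta> ^^ j) (src \<Lambda> y) = rg \<Lambda> z"
      by (cases l; cases m; cases n) (auto simp: X)
    have c: "src \<Lambda> x = (\<alpha> ^^ i) (rg \<Lambda> y)" "src \<Lambda> y = (\<alpha> ^^ j) (rg \<Lambda> z)" using comp lm by blast+
    show "(l \<cdot>\<^bsub>?X\<^esub> m) \<cdot>\<^bsub>?X\<^esub> n = l \<cdot>\<^bsub>?X\<^esub> (m \<cdot>\<^bsub>?X\<^esub> n)"
      using lm c by (auto simp: X acmp cmp_assoc funpow_add)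
  next
    fix l m n assume h: "l \<in> arrows ?X" "m \<in> Nk (k+1)" "n \<in> Nk (k+1)" "dg ?X l = m + n"
    obtain x t where l: "l = (x,t)" "x \<in> arrows \<Lambda>" using h(1) by (cases l) (auto simp: X)
    let ?m = "m(Suc k := 0)" and ?n = "n(Suc k := 0)"
    have mn: "?m \<in> Nk k" "?n \<in> Nk k" using h(2,3) by (auto simp: Nk_def)
    have e: "(dg \<Lambda> x)(Suc k := t) = m + n" using h(4) l by (simp add: X)
    have t: "t = m (Suc k) + n (Suc k)" using fun_cong[OF e, of "Suc k"] by simp
    have d: "dg \<Lambda> x = ?m + ?n"
    proof
      fix i show "dg \<Lambda> x i = (?m + ?n) i" using fun_cong[OF e, of i] upd[OF l(2)] by (cases "i = Suc k") auto
    qed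
    let ?P = "\<lambda>(\<mu>, \<nu>). \<mu> \<in> arrows \<Lambda> \<and> \<nu> \<in> arrows \<Lambda> \<and> dg \<Lambda> \<mu> = ?m \<and> dg \<Lambda> \<nu> = ?n \<and> src \<Lambda> \<mu> = rg \<Lambda> \<nu> \<and> x = \<mu> \<cdot>\<^bsub>\<Lambda>\<^esub> \<nu>"
    have ex: "\<exists>!p. ?P p" by (rule factorisation[OF l(2) mn d])
    then obtain u v where uv: "?P (u, v)" by (auto elim!: ex1E)
    let ?Q = "\<lambda>(\<mu>, \<nu>). \<mu> \<in> arrows ?X \<and> \<nu> \<in> arrows ?X \<and> dg ?X \<mu> = m \<and> dg ?X \<nu> = n \<and> src ?X \<mu> = rg ?X \<nu> \<and> l = \<mu> \<cdot>\<^bsub>?X\<^esub> \<nu>"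
    let ?a = "m (Suc k)"
    have "?Q ((u, ?a), ((\<beta> ^^ ?a) v, n (Suc k)))"
      using uv l t by (auto simp: X fun_eq_iff)
    moreover have "p = ((u, ?a), ((\<beta> ^^ ?a) v, n (Suc k)))" if Q: "?Q p" for p
    proof -
      obtain y i z j where p: "p = ((y,i),(z,j))" by (metis surj_pair)
      have q: "y \<in> arrows \<Lambda>" "z \<in> arrows \<Lambda>" "(dg \<Lambda> y)(Suc k := i) = m" "(dg \<Lambda> z)(Suc k := j) = n"
        "(\<beta> ^^ i) (src \<Lambda> y) = rg \<Lambda> z" "x = y \<cdot>\<^bsub>\<Lambda>\<^esub> (\<alpha> ^^ i) z"
        using Q by (auto simp: X p l)
      have ij: "i = ?a" "j = n (Suc k)" using q(3,4) by auto
      have c: "src \<Lambda> y = (\<alpha> ^^ i) (rg \<Lambda> z)" using comp q by blast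
      have dd: "dg \<Lambda> y = ?m" "dg \<Lambda> z = ?n" using q(3,4)[symmetric] upd[OF q(1)] upd[OF q(2)] by (auto simp: fun_eq_iff)
      have "?P (y, (\<alpha> ^^ i) z)" using q c dd by auto
      then have "(y, (\<alpha> ^^ i) z) = (u, v)" using ex uv by blast
      then show ?thesis using p ij q(2) by auto
    qed
    ultimately show "\<exists>!p. ?Q p" by (rule ex1I)
  qed
qed


section \<open>Cubical homology\<close>

definition cubes :: "nat \<Rightarrow> 'a kgraph_data \<Rightarrow> nat \<Rightarrow> 'a set" where
  "cubes k \<Lambda> r = {\<xi> \<in> arrows \<Lambda>. dg \<Lambda> \<xi> \<le> ones k \<and> (\<Sum>i=1..k. dg \<Lambda> \<xi> i) = r}"

text \<open>
  For a cube \<open>\<xi>\<close> of degree \<open>e\<^bsub>i\<^sub>1\<^esub> + \<dots> + e\<^bsub>i\<^sub>r\<^esub>\<close> with \<open>i\<^sub>1 < \<dots> < i\<^sub>r\<close>, this is \<open>i\<^sub>j\<close> (\<open>1 \<le> j \<le> r\<close>); list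
  positions are counted from 0.
\<close>

definition cube_dir :: "'a kgraph_data \<Rightarrow> 'a \<Rightarrow> nat \<Rightarrow> nat" where
  "cube_dir \<Lambda> \<xi> j = sorted_list_of_set {i. dg \<Lambda> \<xi> i \<noteq> 0} ! (j - 1)"

definition face :: "nat \<Rightarrow> 'a kgraph_data \<Rightarrow> nat \<Rightarrow> nat \<Rightarrow> nat \<Rightarrow> 'a \<Rightarrow> 'a" where
  "face k \<Lambda> r l j \<xi> =
     (if l = 0
      then THE \<mu>. \<mu> \<in> cubes k \<Lambda> (r - 1) \<and>
             (\<exists>\<beta>\<in>arrows \<Lambda>. dg \<Lambda> \<beta> = gen (cube_dir \<Lambda> \<xi> j) \<and> src \<Lambda> \<mu> = rg \<Lambda> \<beta> \<and> \<mu> \<cdot>\<^bsub>\<Lambda>\<^esub> \<beta> = \<xi>)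
      else THE \<nu>. \<nu> \<in> cubes k \<Lambda> (r - 1) \<and>
             (\<exists>\<alpha>\<in>arrows \<Lambda>. dg \<Lambda> \<alpha> = gen (cube_dir \<Lambda> \<xi> j) \<and> src \<Lambda> \<alpha> = rg \<Lambda> \<nu> \<and> \<xi> = \<alpha> \<cdot>\<^bsub>\<Lambda>\<^esub> \<nu>))"

definition cube_chains :: "nat \<Rightarrow> 'a kgraph_data \<Rightarrow> nat \<Rightarrow> ('a \<Rightarrow>\<^sub>0 int) monoid" where
  "cube_chains k \<Lambda> r = free_Abelian_group (cubes k \<Lambda> r)"

text \<open>For \<open>r = 0\<close> the sum over \<open>i\<close> is empty, so \<open>\<partial>\<^sub>0 = 0\<close>.\<close>

definition boundary :: "nat \<Rightarrow> 'a kgraph_data \<Rightarrow> nat \<Rightarrow> ('a \<Rightarrow>\<^sub>0 int) \<Rightarrow> ('a \<Rightarrow>\<^sub>0 int)" where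
  "boundary k \<Lambda> r =
     frag_extend (\<lambda>\<xi>. \<Sum>l=0..1. \<Sum>i=1..r. frag_cmul ((-1) ^ (i + l)) (frag_of (face k \<Lambda> r l i \<xi>)))"

text \<open>For \<open>r = 0\<close> the group of cycles is all of \<open>C\<^sub>0\<close>, whatever the target group of \<open>\<partial>\<^sub>0\<close> is.\<close>

definition cycles :: "nat \<Rightarrow> 'a kgraph_data \<Rightarrow> nat \<Rightarrow> ('a \<Rightarrow>\<^sub>0 int) set" where
  "cycles k \<Lambda> r = kernel (cube_chains k \<Lambda> r) (cube_chains k \<Lambda> (r - 1)) (boundary k \<Lambda> r)"

definition boundaries :: "nat \<Rightarrow> 'a kgraph_data \<Rightarrow> nat \<Rightarrow> ('a \<Rightarrow>\<^sub>0 int) set" where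
  "boundaries k \<Lambda> r = boundary k \<Lambda> (r + 1) ` carrier (cube_chains k \<Lambda> (r + 1))"

definition homology :: "nat \<Rightarrow> 'a kgraph_data \<Rightarrow> nat \<Rightarrow> ('a \<Rightarrow>\<^sub>0 int) set monoid" where
  "homology k \<Lambda> r = (cube_chains k \<Lambda> r)\<lparr>carrier := cycles k \<Lambda> r\<rparr> Mod boundaries k \<Lambda> r"

text \<open>
  The map \<open>[c] \<mapsto> [f c]\<close> into \<open>H\<^sub>r(\<Lambda>)\<close>. A class \<open>X\<close> is sent to \<open>\<Union>c\<in>X. boundaries + f c\<close>.
  If this set is a coset of the boundaries at all, then it is the coset of \<open>f c\<close> for every
  representative \<open>c\<close> of \<open>X\<close>; so being a map into the homology group is the same as being well
  defined on classes, and no representative has to be chosen.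
\<close>

definition homology_map ::
  "nat \<Rightarrow> 'a kgraph_data \<Rightarrow> nat \<Rightarrow> (('b \<Rightarrow>\<^sub>0 int) \<Rightarrow> ('a \<Rightarrow>\<^sub>0 int)) \<Rightarrow> ('b \<Rightarrow>\<^sub>0 int) set \<Rightarrow> ('a \<Rightarrow>\<^sub>0 int) set"
  where "homology_map k \<Lambda> r f X = boundaries k \<Lambda> r <#>\<^bsub>cube_chains k \<Lambda> r\<^esub> f ` X"

definition alpha_star :: "nat \<Rightarrow> 'a kgraph_data \<Rightarrow> ('a \<Rightarrow> 'a) \<Rightarrow> nat \<Rightarrow> ('a \<Rightarrow>\<^sub>0 int) set \<Rightarrow> ('a \<Rightarrow>\<^sub>0 int) set" where
  "alpha_star k \<Lambda> \<alpha> r = homology_map k \<Lambda> r (frag_extend (\<lambda>\<xi>. frag_of (\<alpha> \<xi>)))"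

definition one_minus_alpha_star ::
  "nat \<Rightarrow> 'a kgraph_data \<Rightarrow> ('a \<Rightarrow> 'a) \<Rightarrow> nat \<Rightarrow> ('a \<Rightarrow>\<^sub>0 int) set \<Rightarrow> ('a \<Rightarrow>\<^sub>0 int) set" where
  "one_minus_alpha_star k \<Lambda> \<alpha> r X =
     X \<otimes>\<^bsub>homology k \<Lambda> r\<^esub> inv\<^bsub>homology k \<Lambda> r\<^esub> (alpha_star k \<Lambda> \<alpha> r X)"

definition iota_star ::
  "nat \<Rightarrow> 'a kgraph_data \<Rightarrow> ('a \<Rightarrow> 'a) \<Rightarrow> nat \<Rightarrow> ('a \<Rightarrow>\<^sub>0 int) set \<Rightarrow> ('a \<times> nat \<Rightarrow>\<^sub>0 int) set" where
  "iota_star k \<Lambda> \<alpha> r =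
     homology_map (k + 1) (crossed_product k \<Lambda> \<alpha>) r (frag_extend (\<lambda>\<xi>. frag_of (\<xi>, 0)))"

text \<open>\<open>\<pi>\<^sub>* : H\<^bsub>r+1\<^esub>(\<Lambda> \<times>\<^sub>\<alpha> \<int>) \<rightarrow> H\<^sub>r(\<Lambda>)\<close>, \<open>[(a,0) + (b,1)] \<mapsto> (-1)\<^sup>r [b]\<close>.\<close>

definition pi_star ::
  "nat \<Rightarrow> 'a kgraph_data \<Rightarrow> nat \<Rightarrow> ('a \<times> nat \<Rightarrow>\<^sub>0 int) set \<Rightarrow> ('a \<Rightarrow>\<^sub>0 int) set" where
  "pi_star k \<Lambda> r =
     homology_map k \<Lambda> r
       (frag_extend (\<lambda>(\<xi>, n). if n = 1 then frag_cmul ((-1) ^ r) (frag_of \<xi>) else 0))"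


section \<open>Exactness\<close>

text \<open>
  The library's \<open>exact_seq\<close> requires all groups to have the same element type, hence this
  heterogeneous version of exactness at the middle term of \<open>G \<rightarrow> H \<rightarrow> K\<close>.
\<close>

definition exact_at ::
  "'a monoid \<Rightarrow> ('a \<Rightarrow> 'b) \<Rightarrow> 'b monoid \<Rightarrow> ('b \<Rightarrow> 'c) \<Rightarrow> 'c monoid \<Rightarrow> bool" where
  "exact_at G f H g K \<longleftrightarrow> group_hom G H f \<and> group_hom H K g \<and> f ` carrier G = kernel H K g"

abbreviation zero_group :: "unit monoid" where
  "zero_group \<equiv> singleton_group ()"

end

theory Submission
  imports Defs
begin

text \<open>
  The crossed product \<open>\<Lambda> \<times>\<^sub>\<alpha> \<int>\<close> is the mapping torus of \<open>\<alpha>\<close>, and the exact sequence is its Wang sequence.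
  An \<open>(r + 1)\<close>-cube of the crossed product either lies in the base, \<open>(\<xi>, 0)\<close>, or is a prism \<open>(\<xi>, 1)\<close> over
  an \<open>r\<close>-cube \<open>\<xi>\<close> of \<open>\<Lambda>\<close>. The prism has the faces \<open>(\<xi>, 0)\<close> and \<open>(\<alpha>\<inverse>(\<xi>), 0)\<close> in the new direction, while its
  other faces are the prisms over the faces of \<open>\<xi>\<close>. Since the new direction comes last,
  \<open>\<partial>(b, 1) = (\<partial> b, 1) + (-1)\<^sup>r\<^sup>+\<^sup>1 (b - \<alpha>\<inverse> b, 0)\<close> (lemma \<open>boundary_prism\<close>).
  So the chains of the crossed product form, up to signs, the mapping cone of \<open>1 - \<alpha>\<inverse>\<close>, and the
  sequence is the long exact sequence of this cone. As \<open>1 - \<alpha>\<inverse> = -\<alpha>\<inverse> (1 - \<alpha>)\<close> with \<open>\<alpha>\<close>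
  invertible, \<open>1 - \<alpha>\<inverse>\<close> may be replaced by \<open>1 - \<alpha>\<close> without changing kernels and images in homology.
  Instead of constructing a connecting map, the three kinds of exactness are verified by chasing
  cycles, using that every chain of the crossed product is uniquely \<open>(a, 0) + (b, 1)\<close>. The
  sequence starts with 0 because \<open>\<Lambda>\<close> has no \<open>(k + 1)\<close>-cubes, and ends with 0 because the crossed
  product has no prisms in degree 0.

  That homology is defined at all requires \<open>\<partial> \<circ> \<partial> = 0\<close> for a \<open>k\<close>-graph. For this, faces are
  labelled by directions and written as segments of paths: by unique factorisation a segment of
  a segment is a segment (\<open>segment_segment\<close>), which makes faces in different directions commute,
  and the signs of the two orders are opposite (\<open>dir_sign_swap\<close>).
\<close>

section \<open>Segments of paths and faces of cubes\<close>

definition dirs :: "'a kgraph_data \<Rightarrow> 'a \<Rightarrow> nat set" where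
  "dirs \<Lambda> \<xi> = {i. dg \<Lambda> \<xi> i \<noteq> 0}"

text \<open>The path \<open>\<xi>(m, m + n)\<close> of the \<open>k\<close>-graph literature: what remains of \<open>\<xi>\<close> after an initial piece of
  degree \<open>m\<close> and a final piece are removed.\<close>

definition segment :: "'a kgraph_data \<Rightarrow> (nat \<Rightarrow> nat) \<Rightarrow> (nat \<Rightarrow> nat) \<Rightarrow> 'a \<Rightarrow> 'a" where
  "segment \<Lambda> m n \<xi> = (THE \<eta>. \<exists>\<mu> \<nu>. \<mu> \<in> arrows \<Lambda> \<and> \<eta> \<in> arrows \<Lambda> \<and> \<nu> \<in> arrows \<Lambda> \<and>
     src \<Lambda> \<mu> = rg \<Lambda> \<eta> \<and> src \<Lambda> \<eta> = rg \<Lambda> \<nu> \<and> dg \<Lambda> \<mu> = m \<and> dg \<Lambda> \<eta> = n \<and> \<xi> = \<mu> \<cdot>\<^bsub>\<Lambda>\<^esub> (\<eta> \<cdot>\<^bsub>\<Lambda>\<^esub> \<nu>))"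

text \<open>Faces are indexed by the direction that is removed, not by its position among the
  directions of the cube. For \<open>l = 0\<close> an edge is removed at the end, otherwise at the start.\<close>

definition dir_face :: "'a kgraph_data \<Rightarrow> nat \<Rightarrow> nat \<Rightarrow> 'a \<Rightarrow> 'a" where
  "dir_face \<Lambda> l i \<xi> = segment \<Lambda> (if l = 0 then 0 else gen i) (dg \<Lambda> \<xi> - gen i) \<xi>"

text \<open>The exponent is the position of \<open>i\<close> in \<open>D\<close>, counted from 1.\<close>

definition dir_sign :: "nat set \<Rightarrow> nat \<Rightarrow> int" where
  "dir_sign D i = (-1) ^ card {j \<in> D. j \<le> i}"

lemma ones_apply: "ones k i = (if i \<in> {1..k} then 1 else 0)"
proof -
  have "ones k i = (\<Sum>j=1..k. gen j i)"
    unfolding ones_def by (induction k) auto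
  then show ?thesis by (simp add: gen_def)
qed

lemma Nk_closed:
  assumes "m \<in> Nk k"
  shows "n \<in> Nk k \<Longrightarrow> m + n \<in> Nk k" "m - n \<in> Nk k"
  using assms by (auto simp: Nk_def)

context k_graph
begin

lemma factor_ex:
  assumes "\<xi> \<in> arrows \<Lambda>" "m \<in> Nk k" "n \<in> Nk k" "dg \<Lambda> \<xi> = m + n"
  obtains \<mu> \<nu> where "\<mu> \<in> arrows \<Lambda>" "\<nu> \<in> arrows \<Lambda>" "dg \<Lambda> \<mu> = m" "dg \<Lambda> \<nu> = n"
    "src \<Lambda> \<mu> = rg \<Lambda> \<nu>" "\<xi> = \<mu> \<cdot> \<nu>"
  using factorisation[OF assms] by (auto elim!: ex1E)

text \<open>Degrees add under composition, so equal degrees on the left force equal degrees on the right, and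
  the factorisation property applies.\<close>

lemma factor_unique:
  assumes "\<mu> \<in> arrows \<Lambda>" "\<nu> \<in> arrows \<Lambda>" "src \<Lambda> \<mu> = rg \<Lambda> \<nu>"
    and "\<mu>' \<in> arrows \<Lambda>" "\<nu>' \<in> arrows \<Lambda>" "src \<Lambda> \<mu>' = rg \<Lambda> \<nu>'"
    and "\<mu> \<cdot> \<nu> = \<mu>' \<cdot> \<nu>'" and "dg \<Lambda> \<mu> = dg \<Lambda> \<mu>'"
  shows "\<mu> = \<mu>'" "\<nu> = \<nu>'"
proof -
  have "dg \<Lambda> \<mu> + dg \<Lambda> \<nu> = dg \<Lambda> \<mu>' + dg \<Lambda> \<nu>'"
    using assms dg_cmp by metis
  then have "dg \<Lambda> \<nu> = dg \<Lambda> \<nu>'"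
    using assms(8) by simp
  moreover have "\<exists>!(\<rho>, \<sigma>). \<rho> \<in> arrows \<Lambda> \<and> \<sigma> \<in> arrows \<Lambda> \<and> dg \<Lambda> \<rho> = dg \<Lambda> \<mu> \<and> dg \<Lambda> \<sigma> = dg \<Lambda> \<nu>
      \<and> src \<Lambda> \<rho> = rg \<Lambda> \<sigma> \<and> \<mu> \<cdot> \<nu> = \<rho> \<cdot> \<sigma>"
    by (rule factorisation) (use assms(1-3) in \<open>auto simp: cmp_arrow dg_Nk dg_cmp\<close>)
  ultimately have "(\<mu>, \<nu>) = (\<mu>', \<nu>')"
    using assms by (elim ex1E) (metis (mono_tags, lifting) case_prodI)
  then show "\<mu> = \<mu>'" "\<nu> = \<nu>'" by simp_all
qed

text \<open>The factorisation property determines first \<open>\<mu>\<close> and the composite \<open>\<eta> \<cdot> \<nu>\<close>, and then \<open>\<eta>\<close>, so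
  a segment can be computed from any such factorisation.\<close>

lemma segment_eqI:
  assumes "\<mu> \<in> arrows \<Lambda>" "\<eta> \<in> arrows \<Lambda>" "\<nu> \<in> arrows \<Lambda>"
    "src \<Lambda> \<mu> = rg \<Lambda> \<eta>" "src \<Lambda> \<eta> = rg \<Lambda> \<nu>"
    "dg \<Lambda> \<mu> = m" "dg \<Lambda> \<eta> = n" "\<xi> = \<mu> \<cdot> (\<eta> \<cdot> \<nu>)"
  shows "segment \<Lambda> m n \<xi> = \<eta>"
  unfolding segment_def
proof (rule the_equality)
  fix \<eta>' assume "\<exists>\<mu> \<nu>. \<mu> \<in> arrows \<Lambda> \<and> \<eta>' \<in> arrows \<Lambda> \<and> \<nu> \<in> arrows \<Lambda> \<and>
     src \<Lambda> \<mu> = rg \<Lambda> \<eta>' \<and> src \<Lambda> \<eta>' = rg \<Lambda> \<nu> \<and> dg \<Lambda> \<mu> = m \<and> dg \<Lambda> \<eta>' = n \<and> \<xi> = \<mu> \<cdot> (\<eta>' \<cdot> \<nu>)"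
  then obtain \<mu>' \<nu>' where h: "\<mu>' \<in> arrows \<Lambda>" "\<eta>' \<in> arrows \<Lambda>" "\<nu>' \<in> arrows \<Lambda>"
     "src \<Lambda> \<mu>' = rg \<Lambda> \<eta>'" "src \<Lambda> \<eta>' = rg \<Lambda> \<nu>'" "dg \<Lambda> \<mu>' = m" "dg \<Lambda> \<eta>' = n" "\<xi> = \<mu>' \<cdot> (\<eta>' \<cdot> \<nu>')"
    by blast
  have "\<eta> \<cdot> \<nu> = \<eta>' \<cdot> \<nu>'"
    by (rule factor_unique(2)[of \<mu> _ \<mu>']) (use assms h in \<open>simp_all add: cmp_arrow rg_cmp\<close>)
  then show "\<eta>' = \<eta>"
    by (metis factor_unique(1) assms(2,3,5,7) h(2,3,5,7))
qed (use assms in blast)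

lemma segment_ex:
  assumes "\<xi> \<in> arrows \<Lambda>" "m + n \<le> dg \<Lambda> \<xi>"
  obtains \<mu> \<eta> \<nu> where "\<mu> \<in> arrows \<Lambda>" "\<eta> \<in> arrows \<Lambda>" "\<nu> \<in> arrows \<Lambda>"
    "src \<Lambda> \<mu> = rg \<Lambda> \<eta>" "src \<Lambda> \<eta> = rg \<Lambda> \<nu>"
    "dg \<Lambda> \<mu> = m" "dg \<Lambda> \<eta> = n" "\<xi> = \<mu> \<cdot> (\<eta> \<cdot> \<nu>)" "segment \<Lambda> m n \<xi> = \<eta>"
proof -
  let ?p = "dg \<Lambda> \<xi> - (m + n)"
  have le: "m i + n i \<le> dg \<Lambda> \<xi> i" for i
    using assms(2) by (simp add: le_fun_def)
  have z: "dg \<Lambda> \<xi> i = 0" if "i \<notin> {1..k}" for i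
    using dg_Nk[OF assms(1)] that by (simp add: Nk_def)
  have N: "m \<in> Nk k" "n \<in> Nk k" "?p \<in> Nk k"
    using le z unfolding Nk_def by (auto, (metis add_eq_0_iff_both_eq_0 le_zero_eq)+)
  have d: "dg \<Lambda> \<xi> = m + (n + ?p)"
    using le by (auto simp: fun_eq_iff add.assoc[symmetric])
  obtain \<mu> \<zeta> where 1: "\<mu> \<in> arrows \<Lambda>" "\<zeta> \<in> arrows \<Lambda>" "dg \<Lambda> \<mu> = m" "dg \<Lambda> \<zeta> = n + ?p"
    "src \<Lambda> \<mu> = rg \<Lambda> \<zeta>" "\<xi> = \<mu> \<cdot> \<zeta>"
    by (rule factor_ex[OF assms(1) N(1) Nk_closed(1)[OF N(2,3)] d])
  obtain \<eta> \<nu> where 2: "\<eta> \<in> arrows \<Lambda>" "\<nu> \<in> arrows \<Lambda>" "dg \<Lambda> \<eta> = n" "dg \<Lambda> \<nu> = ?p"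
    "src \<Lambda> \<eta> = rg \<Lambda> \<nu>" "\<zeta> = \<eta> \<cdot> \<nu>"
    by (rule factor_ex[OF 1(2) N(2,3) 1(4)])
  show thesis
    using 1 2 by (intro that[of \<mu> \<eta> \<nu>] segment_eqI[of \<mu> \<eta> \<nu>]) (simp_all add: rg_cmp)
qed

lemma segment_arrow:
  assumes "\<xi> \<in> arrows \<Lambda>" "m + n \<le> dg \<Lambda> \<xi>"
  shows "segment \<Lambda> m n \<xi> \<in> arrows \<Lambda>" "dg \<Lambda> (segment \<Lambda> m n \<xi>) = n"
  using assms by (metis segment_ex)+

text \<open>By associativity a segment of a segment is a segment. This identity contains all four
  commutation rules for initial and final faces.\<close>

lemma segment_segment:
  assumes "\<xi> \<in> arrows \<Lambda>" "m + n \<le> dg \<Lambda> \<xi>" "p + q \<le> n"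
  shows "segment \<Lambda> p q (segment \<Lambda> m n \<xi>) = segment \<Lambda> (m + p) q \<xi>"
proof -
  obtain \<mu> \<eta> \<nu> where 1: "\<mu> \<in> arrows \<Lambda>" "\<eta> \<in> arrows \<Lambda>" "\<nu> \<in> arrows \<Lambda>"
    "src \<Lambda> \<mu> = rg \<Lambda> \<eta>" "src \<Lambda> \<eta> = rg \<Lambda> \<nu>"
    "dg \<Lambda> \<mu> = m" "dg \<Lambda> \<eta> = n" "\<xi> = \<mu> \<cdot> (\<eta> \<cdot> \<nu>)" "segment \<Lambda> m n \<xi> = \<eta>"
    by (rule segment_ex[OF assms(1,2)])
  have "p + q \<le> dg \<Lambda> \<eta>" using assms 1 by simp
  then obtain \<mu>' \<eta>' \<nu>' where 2: "\<mu>' \<in> arrows \<Lambda>" "\<eta>' \<in> arrows \<Lambda>" "\<nu>' \<in> arrows \<Lambda>"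
    "src \<Lambda> \<mu>' = rg \<Lambda> \<eta>'" "src \<Lambda> \<eta>' = rg \<Lambda> \<nu>'"
    "dg \<Lambda> \<mu>' = p" "dg \<Lambda> \<eta>' = q" "\<eta> = \<mu>' \<cdot> (\<eta>' \<cdot> \<nu>')" "segment \<Lambda> p q \<eta> = \<eta>'"
    by (rule segment_ex[OF 1(2)])
  note cl = cmp_arrow rg_cmp src_cmp dg_cmp cmp_assoc
  have s: "src \<Lambda> \<mu> = rg \<Lambda> \<mu>'" "src \<Lambda> \<nu>' = rg \<Lambda> \<nu>"
    using 1 2 by (simp_all add: cl)
  have "segment \<Lambda> (m + p) q \<xi> = \<eta>'"
    by (rule segment_eqI[of "\<mu> \<cdot> \<mu>'" _ "\<nu>' \<cdot> \<nu>"]) (use 1 2 s in \<open>simp_all add: cl\<close>)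
  then show ?thesis using 1 2 by simp
qed

lemma dirs_subset: "\<xi> \<in> arrows \<Lambda> \<Longrightarrow> dirs \<Lambda> \<xi> \<subseteq> {1..k}"
  using dg_Nk[of \<xi>] by (auto simp: Nk_def dirs_def)

lemma finite_dirs: "\<xi> \<in> arrows \<Lambda> \<Longrightarrow> finite (dirs \<Lambda> \<xi>)"
  using dirs_subset finite_subset by blast

text \<open>Cubes have degrees with entries 0 and 1, so the total degree counts the directions.\<close>

lemma cubes_iff:
  "\<xi> \<in> cubes k \<Lambda> r \<longleftrightarrow> \<xi> \<in> arrows \<Lambda> \<and> (\<forall>i. dg \<Lambda> \<xi> i \<le> 1) \<and> card (dirs \<Lambda> \<xi>) = r"
proof (cases "\<xi> \<in> arrows \<Lambda>")
  case True
  have z: "dg \<Lambda> \<xi> i = 0" if "i \<notin> {1..k}" for i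
    using dg_Nk[OF True] that by (simp add: Nk_def)
  then have le: "dg \<Lambda> \<xi> \<le> ones k \<longleftrightarrow> (\<forall>i. dg \<Lambda> \<xi> i \<le> 1)"
  proof -
    have "dg \<Lambda> \<xi> i \<le> ones k i \<longleftrightarrow> dg \<Lambda> \<xi> i \<le> 1" for i
      using z[of i] by (cases "i \<in> {1..k}") (simp_all only: ones_apply, simp_all)
    then show ?thesis unfolding le_fun_def by simp
  qed
  have "(\<Sum>i=1..k. dg \<Lambda> \<xi> i) = card (dirs \<Lambda> \<xi>)" if "\<forall>i. dg \<Lambda> \<xi> i \<le> 1"
  proof -
    have 1: "dg \<Lambda> \<xi> i = 1" if "i \<in> dirs \<Lambda> \<xi>" for i
      using \<open>\<forall>i. dg \<Lambda> \<xi> i \<le> 1\<close>[rule_format, of i] that by (simp add: dirs_def)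
    have "(\<Sum>i=1..k. dg \<Lambda> \<xi> i) = (\<Sum>i\<in>dirs \<Lambda> \<xi>. dg \<Lambda> \<xi> i)"
      by (rule sum.mono_neutral_right) (use dirs_subset[OF True] in \<open>auto simp: dirs_def\<close>)
    then show ?thesis using 1 by simp
  qed
  then have "(\<forall>i. dg \<Lambda> \<xi> i \<le> 1) \<and> (\<Sum>i=1..k. dg \<Lambda> \<xi> i) = r \<longleftrightarrow> (\<forall>i. dg \<Lambda> \<xi> i \<le> 1) \<and> card (dirs \<Lambda> \<xi>) = r"
    by (intro conj_cong refl) simp
  then show ?thesis
    unfolding cubes_def mem_Collect_eq le by (simp only: True)
qed (simp only: cubes_def mem_Collect_eq simp_thms)

lemma cube_dg:
  assumes "\<xi> \<in> cubes k \<Lambda> r"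
  shows "dg \<Lambda> \<xi> i = (if i \<in> dirs \<Lambda> \<xi> then 1 else 0)"
proof -
  have "dg \<Lambda> \<xi> i \<le> 1" using assms unfolding cubes_iff by blast
  then show ?thesis unfolding dirs_def mem_Collect_eq by (simp split: if_split)
qed

lemma gen_le:
  assumes "i \<in> dirs \<Lambda> \<xi>" shows "gen i + (dg \<Lambda> \<xi> - gen i) = dg \<Lambda> \<xi>"
  using assms by (auto simp: dirs_def gen_def fun_eq_iff)

lemma edge_Nk:
  assumes "\<xi> \<in> arrows \<Lambda>" "i \<in> dirs \<Lambda> \<xi>"
  shows "gen i \<in> Nk k" "dg \<Lambda> \<xi> - gen i \<in> Nk k"
proof -
  show "gen i \<in> Nk k" using dirs_subset[OF assms(1)] assms(2) by (auto simp: Nk_def gen_def)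
  show "dg \<Lambda> \<xi> - gen i \<in> Nk k" by (rule Nk_closed(2)[OF dg_Nk[OF assms(1)]])
qed

lemma dir_face_start_le:
  assumes "i \<in> dirs \<Lambda> \<xi>" shows "(if l = 0 then 0 else gen i) + (dg \<Lambda> \<xi> - gen i) \<le> dg \<Lambda> \<xi>"
  using fun_cong[OF gen_le[OF assms]] by (auto simp: le_fun_def)

lemma dir_face_arrow:
  assumes "\<xi> \<in> arrows \<Lambda>" "i \<in> dirs \<Lambda> \<xi>"
  shows "dir_face \<Lambda> l i \<xi> \<in> arrows \<Lambda>" "dg \<Lambda> (dir_face \<Lambda> l i \<xi>) = dg \<Lambda> \<xi> - gen i"
  unfolding dir_face_def
  using segment_arrow[OF assms(1) dir_face_start_le[OF assms(2), of l]] by simp_all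

lemma dirs_dir_face:
  assumes "\<xi> \<in> cubes k \<Lambda> r" "i \<in> dirs \<Lambda> \<xi>"
  shows "dirs \<Lambda> (dir_face \<Lambda> l i \<xi>) = dirs \<Lambda> \<xi> - {i}"
proof -
  have x: "\<xi> \<in> arrows \<Lambda>" using assms unfolding cubes_iff by blast
  have "dg \<Lambda> \<xi> i = 1" using cube_dg[OF assms(1), of i] assms(2) by simp
  then have "(dg \<Lambda> \<xi> - gen i) j \<noteq> 0 \<longleftrightarrow> dg \<Lambda> \<xi> j \<noteq> 0 \<and> j \<noteq> i" for j
    by (simp add: gen_def)
  then show ?thesis
    unfolding dirs_def dir_face_arrow(2)[OF x assms(2)] by blast
qed

lemma dir_face_cube:
  assumes "\<xi> \<in> cubes k \<Lambda> r" "i \<in> dirs \<Lambda> \<xi>"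
  shows "dir_face \<Lambda> l i \<xi> \<in> cubes k \<Lambda> (r - 1)"
proof -
  have x: "\<xi> \<in> arrows \<Lambda>" using assms by (simp add: cubes_iff)
  note d = dir_face_arrow[OF x assms(2), of l]
  have "dg \<Lambda> \<xi> j - gen i j \<le> 1" for j
    using assms(1) diff_le_self le_trans unfolding cubes_iff by blast
  then show ?thesis
    using assms d dirs_dir_face[OF assms, of l] by (auto simp: cubes_iff)
qed

text \<open>Both sides are the same segment: removing an edge at the start moves the starting degree, removing one
  at the end does not, and the two changes of degree are added in either order.\<close>

lemma dir_face_commute:
  assumes "\<xi> \<in> cubes k \<Lambda> r" "i \<in> dirs \<Lambda> \<xi>" "j \<in> dirs \<Lambda> \<xi>" "i \<noteq> j"
  shows "dir_face \<Lambda> m j (dir_face \<Lambda> l i \<xi>) = dir_face \<Lambda> l i (dir_face \<Lambda> m j \<xi>)"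
proof -
  have x: "\<xi> \<in> arrows \<Lambda>" using assms by (simp add: cubes_iff)
  have iter: "dir_face \<Lambda> m j (dir_face \<Lambda> l i \<xi>) =
      segment \<Lambda> ((if l = 0 then 0 else gen i) + (if m = 0 then 0 else gen j)) (dg \<Lambda> \<xi> - gen i - gen j) \<xi>"
    if "i \<in> dirs \<Lambda> \<xi>" "j \<in> dirs \<Lambda> \<xi>" "i \<noteq> j" for i j l m
  proof -
    have "j \<in> dirs \<Lambda> (dir_face \<Lambda> l i \<xi>)"
      using dirs_dir_face[OF assms(1) that(1)] that by simp
    from dir_face_start_le[OF this, of m] show ?thesis
      unfolding dir_face_def[of _ m j] dir_face_arrow(2)[OF x that(1)]
      unfolding dir_face_def[of _ l i]
      by (rule segment_segment[OF x dir_face_start_le[OF that(1)]])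
  qed
  have "dg \<Lambda> \<xi> - gen i - gen j = dg \<Lambda> \<xi> - gen j - gen i"
    by (auto simp: fun_eq_iff)
  then show ?thesis
    using iter[OF assms(2,3,4), of m l] iter[OF assms(3,2) assms(4)[symmetric], of l m]
    by (simp only: add.commute)
qed

lemma dir_face_eqI:
  assumes "\<mu> \<in> arrows \<Lambda>" "\<nu> \<in> arrows \<Lambda>" "src \<Lambda> \<mu> = rg \<Lambda> \<nu>" "\<xi> = \<mu> \<cdot> \<nu>"
  shows "dg \<Lambda> \<nu> = gen i \<Longrightarrow> dir_face \<Lambda> 0 i \<xi> = \<mu>"
    and "dg \<Lambda> \<mu> = gen i \<Longrightarrow> l \<noteq> 0 \<Longrightarrow> dir_face \<Lambda> l i \<xi> = \<nu>"
proof -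
  have d: "dg \<Lambda> \<xi> = dg \<Lambda> \<mu> + dg \<Lambda> \<nu>" using assms dg_cmp by simp
  show "dir_face \<Lambda> 0 i \<xi> = \<mu>" if "dg \<Lambda> \<nu> = gen i"
    unfolding dir_face_def
    by (rule segment_eqI[of "rg \<Lambda> \<mu>" \<mu> \<nu>])
       (use assms d that in \<open>auto simp: rg_arrow src_rg dg_rg cmp_assoc[symmetric] cmp_id_left cmp_arrow fun_eq_iff\<close>)
  show "dir_face \<Lambda> l i \<xi> = \<nu>" if "dg \<Lambda> \<mu> = gen i" "l \<noteq> 0"
    unfolding dir_face_def
    by (rule segment_eqI[of \<mu> \<nu> "src \<Lambda> \<nu>"])
       (use assms d that in \<open>auto simp: src_arrow rg_src cmp_id_right fun_eq_iff\<close>)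
qed

text \<open>Here the face at a position is identified with the face in the corresponding direction; the
  uniqueness of factorisations shows that the description in the definition has one solution.\<close>

lemma face_eq_dir_face:
  assumes x: "\<xi> \<in> cubes k \<Lambda> r" and i: "cube_dir \<Lambda> \<xi> j = i" "i \<in> dirs \<Lambda> \<xi>"
  shows "face k \<Lambda> r l j \<xi> = dir_face \<Lambda> l i \<xi>"
proof -
  have xa: "\<xi> \<in> arrows \<Lambda>" using x by (simp add: cubes_iff)
  note N = edge_Nk[OF xa i(2)]
  note e = gen_le[OF i(2)]
  show ?thesis
  proof (cases "l = 0")
    case True
    obtain \<mu> \<nu> where f: "\<mu> \<in> arrows \<Lambda>" "\<nu> \<in> arrows \<Lambda>" "dg \<Lambda> \<mu> = dg \<Lambda> \<xi> - gen i" "dg \<Lambda> \<nu> = gen i"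
      "src \<Lambda> \<mu> = rg \<Lambda> \<nu>" "\<xi> = \<mu> \<cdot> \<nu>"
      by (rule factor_ex[OF xa N(2,1)]) (use e in \<open>simp add: add.commute\<close>)
    have m: "dir_face \<Lambda> 0 i \<xi> = \<mu>" by (rule dir_face_eqI) (use f in auto)
    have "(THE \<mu>. \<mu> \<in> cubes k \<Lambda> (r - 1) \<and>
             (\<exists>\<beta>\<in>arrows \<Lambda>. dg \<Lambda> \<beta> = gen (cube_dir \<Lambda> \<xi> j) \<and> src \<Lambda> \<mu> = rg \<Lambda> \<beta> \<and> \<mu> \<cdot> \<beta> = \<xi>)) = \<mu>"
    proof (rule the_equality)
      show "\<mu> \<in> cubes k \<Lambda> (r - 1) \<and>
             (\<exists>\<beta>\<in>arrows \<Lambda>. dg \<Lambda> \<beta> = gen (cube_dir \<Lambda> \<xi> j) \<and> src \<Lambda> \<mu> = rg \<Lambda> \<beta> \<and> \<mu> \<cdot> \<beta> = \<xi>)"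
        using dir_face_cube[OF x i(2), of 0] f i m by auto
    qed (use dir_face_eqI(1) i m in \<open>auto simp: cubes_iff\<close>)
    then show ?thesis using True m by (simp add: face_def)
  next
    case False
    obtain \<mu> \<nu> where f: "\<mu> \<in> arrows \<Lambda>" "\<nu> \<in> arrows \<Lambda>" "dg \<Lambda> \<mu> = gen i" "dg \<Lambda> \<nu> = dg \<Lambda> \<xi> - gen i"
      "src \<Lambda> \<mu> = rg \<Lambda> \<nu>" "\<xi> = \<mu> \<cdot> \<nu>"
      by (rule factor_ex[OF xa N]) (use e in simp)
    have m: "dir_face \<Lambda> l i \<xi> = \<nu>" by (rule dir_face_eqI) (use f False in auto)
    have "(THE \<nu>. \<nu> \<in> cubes k \<Lambda> (r - 1) \<and>
             (\<exists>\<alpha>\<in>arrows \<Lambda>. dg \<Lambda> \<alpha> = gen (cube_dir \<Lambda> \<xi> j) \<and> src \<Lambda> \<alpha> = rg \<Lambda> \<nu> \<and> \<xi> = \<alpha> \<cdot> \<nu>)) = \<nu>"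
    proof (rule the_equality)
      show "\<nu> \<in> cubes k \<Lambda> (r - 1) \<and>
             (\<exists>\<alpha>\<in>arrows \<Lambda>. dg \<Lambda> \<alpha> = gen (cube_dir \<Lambda> \<xi> j) \<and> src \<Lambda> \<alpha> = rg \<Lambda> \<nu> \<and> \<xi> = \<alpha> \<cdot> \<nu>)"
        using dir_face_cube[OF x i(2), of l] f i m by auto
    qed (use dir_face_eqI(2) False i m in \<open>auto simp: cubes_iff\<close>)
    then show ?thesis using False m by (simp add: face_def)
  qed
qed

end

section \<open>The boundary map\<close>

text \<open>Counting the elements up to \<open>i\<close> recovers the position of \<open>i\<close> in the sorted list, so summing over
  positions is summing over elements.\<close>

lemma sum_over_positions:
  fixes D :: "nat set" and g :: "nat \<Rightarrow> nat \<Rightarrow> 'b::comm_monoid_add"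
  assumes "finite D"
  shows "(\<Sum>j=1..card D. g (sorted_list_of_set D ! (j - 1)) j) = (\<Sum>i\<in>D. g i (card {j \<in> D. j \<le> i}))"
proof -
  define xs where "xs = sorted_list_of_set D"
  have xs: "sorted_wrt (<) xs" "set xs = D" "length xs = card D"
    using assms by (auto simp: xs_def)
  have ord: "xs ! a \<le> xs ! b \<longleftrightarrow> a \<le> b" if "a < card D" "b < card D" for a b
    using that xs by (metis sorted_wrt_nth_less linorder_not_le nat_less_le order.order_iff_strict)
  have inj: "inj_on (\<lambda>j. xs ! (j - 1)) {1..card D}"
  proof (rule inj_onI)
    fix a b assume ab: "a \<in> {1..card D}" "b \<in> {1..card D}" "xs ! (a - 1) = xs ! (b - 1)"
    then have "a - 1 \<le> b - 1" "b - 1 \<le> a - 1"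
      using ord[of "a - 1" "b - 1"] ord[of "b - 1" "a - 1"] by auto
    then show "a = b" using ab by auto
  qed
  have im: "(\<lambda>j. xs ! (j - 1)) ` {1..card D} = D"
  proof -
    have "(\<lambda>j. xs ! (j - 1)) ` {1..card D} = (\<lambda>j. xs ! j) ` {..<card D}"
      by (force simp: image_iff intro: bexI[of _ "Suc _"])
    then show ?thesis using xs by (auto simp: set_conv_nth)
  qed
  have c: "card {x \<in> D. x \<le> xs ! (j - 1)} = j" if "j \<in> {1..card D}" for j
  proof -
    have "{x \<in> D. x \<le> xs ! (j - 1)} = (\<lambda>j. xs ! (j - 1)) ` {1..j}"
    proof (intro equalityI subsetI)
      fix x assume "x \<in> {x \<in> D. x \<le> xs ! (j - 1)}"
      then have "x \<in> (\<lambda>j. xs ! (j - 1)) ` {1..card D}" "x \<le> xs ! (j - 1)"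
        unfolding im by simp_all
      then obtain a where "a \<in> {1..card D}" "x = xs ! (a - 1)" "xs ! (a - 1) \<le> xs ! (j - 1)"
        by blast
      moreover from this have "a - 1 \<le> j - 1"
        using that by (subst ord[symmetric]) auto
      ultimately have "x = xs ! (a - 1)" "a \<in> {1..j}"
        using that by auto
      then show "x \<in> (\<lambda>j. xs ! (j - 1)) ` {1..j}" by blast
    next
      fix x assume "x \<in> (\<lambda>j. xs ! (j - 1)) ` {1..j}"
      then obtain a where a: "a \<in> {1..j}" "x = xs ! (a - 1)" by blast
      then have "x \<in> D" using im that by auto
      moreover have "x \<le> xs ! (j - 1)" using ord[of "a - 1" "j - 1"] that a by auto
      ultimately show "x \<in> {x \<in> D. x \<le> xs ! (j - 1)}" by simp
    qed
    then show ?thesis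
      using card_image[OF inj_on_subset[OF inj]] that by simp
  qed
  have "(\<Sum>i\<in>D. g i (card {j \<in> D. j \<le> i})) = (\<Sum>j=1..card D. g (xs ! (j - 1)) (card {x \<in> D. x \<le> xs ! (j - 1)}))"
    using sum.reindex[OF inj, of "\<lambda>i. g i (card {j \<in> D. j \<le> i})"] im by simp
  then show ?thesis using c by (simp add: xs_def)
qed

text \<open>If \<open>i < j\<close>, then the removal of \<open>j\<close> does not affect the position of \<open>i\<close>, whereas the removal of \<open>i\<close>
  lowers the position of \<open>j\<close> by one. This is the source of all cancellation in \<open>\<partial> \<circ> \<partial>\<close>.\<close>

lemma dir_sign_swap:
  assumes "finite D" "i \<in> D" "j \<in> D" "i \<noteq> j"
  shows "dir_sign D i * dir_sign (D - {i}) j = - (dir_sign D j * dir_sign (D - {j}) i)"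
proof -
  have *: "dir_sign D i * dir_sign (D - {i}) j = - (dir_sign D j * dir_sign (D - {j}) i)"
    if "i \<in> D" "i < j" for i j
  proof -
    have "{x \<in> D - {j}. x \<le> i} = {x \<in> D. x \<le> i}" using that by auto
    moreover have "card {x \<in> D. x \<le> j} = Suc (card {x \<in> D - {i}. x \<le> j})"
    proof -
      have "{x \<in> D. x \<le> j} = insert i {x \<in> D - {i}. x \<le> j}" using that by auto
      also have "card \<dots> = Suc (card {x \<in> D - {i}. x \<le> j})"
        using assms(1) by (intro card_insert_disjoint) auto
      finally show ?thesis .
    qed
    ultimately show ?thesis unfolding dir_sign_def by simp
  qed
  show ?thesis
  proof (cases "i < j")
    case True then show ?thesis using * assms by blast
  next
    case False
    then have "j < i" using assms(4) by simp
    then show ?thesis using *[of j i] assms(3) by linarith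
  qed
qed

text \<open>Swapping the two summation indices negates the sum, and a free abelian group has no 2-torsion.\<close>

lemma antisymmetric_sum_zero:
  fixes g :: "'a \<Rightarrow> 'a \<Rightarrow> ('b \<Rightarrow>\<^sub>0 int)"
  assumes "finite P" "\<And>p q. p \<in> P \<Longrightarrow> q \<in> P \<Longrightarrow> g p q = - g q p"
  shows "(\<Sum>p\<in>P. \<Sum>q\<in>P. g p q) = 0"
proof -
  define S where "S = (\<Sum>p\<in>P. \<Sum>q\<in>P. g p q)"
  have "S = (\<Sum>p\<in>P. \<Sum>q\<in>P. - g q p)" unfolding S_def by (intro sum.cong refl assms(2))
  also have "\<dots> = - (\<Sum>p\<in>P. \<Sum>q\<in>P. g q p)" by (simp add: sum_negf)
  also have "(\<Sum>p\<in>P. \<Sum>q\<in>P. g q p) = S" unfolding S_def by (rule sum.swap)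
  finally have eq: "S = - S" .
  have "Poly_Mapping.lookup S x = 0" for x
    using arg_cong[OF eq, of "\<lambda>c. Poly_Mapping.lookup c x"] unfolding lookup_uminus by linarith
  then show ?thesis unfolding S_def[symmetric] by (intro poly_mapping_eqI) simp
qed

context k_graph
begin

text \<open>Directions, unlike positions, keep their names when a face is taken, so this form of the boundary can be
  iterated without renumbering.\<close>

lemma boundary_cube:
  assumes "\<xi> \<in> cubes k \<Lambda> r"
  shows "boundary k \<Lambda> r (frag_of \<xi>) = (\<Sum>i\<in>dirs \<Lambda> \<xi>. \<Sum>l\<in>{0..1}.
     frag_cmul (dir_sign (dirs \<Lambda> \<xi>) i * (-1) ^ l) (frag_of (dir_face \<Lambda> l i \<xi>)))"
proof -
  let ?D = "dirs \<Lambda> \<xi>"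
  have D: "finite ?D" "card ?D = r"
    using assms finite_dirs by (auto simp: cubes_iff)
  have cd: "cube_dir \<Lambda> \<xi> j = sorted_list_of_set ?D ! (j - 1)" for j
    by (simp add: cube_dir_def dirs_def)
  have mem: "cube_dir \<Lambda> \<xi> j \<in> ?D" if "j \<in> {1..r}" for j
  proof -
    have "j - 1 < length (sorted_list_of_set ?D)" using that D by auto
    then have "sorted_list_of_set ?D ! (j - 1) \<in> set (sorted_list_of_set ?D)" by (rule nth_mem)
    then show ?thesis using D cd by simp
  qed
  have face: "face k \<Lambda> r l j \<xi> = dir_face \<Lambda> l (sorted_list_of_set ?D ! (j - 1)) \<xi>" if "j \<in> {1..r}" for l j
    by (rule face_eq_dir_face[OF assms cd]) (use mem[OF that] cd in simp)
  have "boundary k \<Lambda> r (frag_of \<xi>) = (\<Sum>l=0..1. \<Sum>j=1..r. frag_cmul ((-1) ^ (j + l)) (frag_of (face k \<Lambda> r l j \<xi>)))"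
    by (simp add: boundary_def)
  also have "\<dots> = (\<Sum>l=0..1. \<Sum>j=1..card ?D. frag_cmul ((-1) ^ (j + l))
        (frag_of (dir_face \<Lambda> l (sorted_list_of_set ?D ! (j - 1)) \<xi>)))"
    unfolding D(2) by (intro sum.cong refl) (simp only: face)
  also have "\<dots> = (\<Sum>l=0..1. \<Sum>i\<in>?D. frag_cmul (dir_sign ?D i * (-1) ^ l) (frag_of (dir_face \<Lambda> l i \<xi>)))"
  proof (rule sum.cong[OF refl])
    fix l
    show "(\<Sum>j=1..card ?D. frag_cmul ((-1) ^ (j + l)) (frag_of (dir_face \<Lambda> l (sorted_list_of_set ?D ! (j - 1)) \<xi>)))
        = (\<Sum>i\<in>?D. frag_cmul (dir_sign ?D i * (-1) ^ l) (frag_of (dir_face \<Lambda> l i \<xi>)))"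
      unfolding dir_sign_def power_add[symmetric]
      by (rule sum_over_positions[OF D(1), of "\<lambda>i j. frag_cmul ((-1) ^ (j + l)) (frag_of (dir_face \<Lambda> l i \<xi>))"])
  qed
  also have "\<dots> = (\<Sum>i\<in>?D. \<Sum>l=0..1. frag_cmul (dir_sign ?D i * (-1) ^ l) (frag_of (dir_face \<Lambda> l i \<xi>)))"
    by (rule sum.swap)
  finally show ?thesis .
qed

lemma boundary_sum: "finite I \<Longrightarrow> boundary k \<Lambda> r (sum c I) = (\<Sum>i\<in>I. boundary k \<Lambda> r (c i))"
  by (simp add: boundary_def frag_extend_sum)

lemma keys_boundary:
  assumes "Poly_Mapping.keys c \<subseteq> cubes k \<Lambda> r"
  shows "Poly_Mapping.keys (boundary k \<Lambda> r c) \<subseteq> cubes k \<Lambda> (r - 1)"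
proof -
  have "Poly_Mapping.keys (boundary k \<Lambda> r (frag_of \<xi>)) \<subseteq> cubes k \<Lambda> (r - 1)" if "\<xi> \<in> cubes k \<Lambda> r" for \<xi>
  proof -
    have "boundary k \<Lambda> r (frag_of \<xi>) \<in> carrier (free_Abelian_group (cubes k \<Lambda> (r - 1)))"
      unfolding boundary_cube[OF that]
      using dir_face_cube[OF that] by (intro sum_closed_free_Abelian_group) (auto simp: keys_frag_of)
    then show ?thesis by simp
  qed
  then have "(\<Union>\<xi>\<in>Poly_Mapping.keys c. Poly_Mapping.keys (boundary k \<Lambda> r (frag_of \<xi>))) \<subseteq> cubes k \<Lambda> (r - 1)"
    using assms by blast
  then show ?thesis
    unfolding boundary_def frag_extend_of by (rule order_trans[OF keys_frag_extend])
qed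

text \<open>The iterated boundary of a cube is a sum over pairs of distinct directions with a choice of end for
  each. Exchanging the two members of a pair keeps the face, because faces commute, and changes the
  sign.\<close>

lemma boundary_boundary:
  assumes "Poly_Mapping.keys c \<subseteq> cubes k \<Lambda> (r + 1)"
  shows "boundary k \<Lambda> r (boundary k \<Lambda> (r + 1) c) = 0"
  using assms
proof (induction c rule: frag_induction)
  case (one \<xi>)
  let ?D = "dirs \<Lambda> \<xi>" and ?P = "dirs \<Lambda> \<xi> \<times> {0..1::nat}"
  have fin: "finite ?D" using one finite_dirs by (auto simp: cubes_iff)
  \<comment> \<open>The diagonal is included with value 0 so that both sums range over the same set.\<close>
  define g where "g = (\<lambda>(i, l) (j, m). if i = j then 0 else
    frag_cmul (dir_sign ?D i * dir_sign (?D - {i}) j * (-1) ^ l * (-1) ^ m)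
      (frag_of (dir_face \<Lambda> m j (dir_face \<Lambda> l i \<xi>))))"
  have inner: "boundary k \<Lambda> r (frag_cmul (dir_sign ?D i * (-1) ^ l) (frag_of (dir_face \<Lambda> l i \<xi>)))
      = (\<Sum>q\<in>?P. g (i, l) q)" if "i \<in> ?D" for i l
  proof -
    have c: "dir_face \<Lambda> l i \<xi> \<in> cubes k \<Lambda> r" using dir_face_cube[OF one that, of l] by simp
    have "boundary k \<Lambda> r (frag_cmul (dir_sign ?D i * (-1) ^ l) (frag_of (dir_face \<Lambda> l i \<xi>)))
       = frag_cmul (dir_sign ?D i * (-1) ^ l) (boundary k \<Lambda> r (frag_of (dir_face \<Lambda> l i \<xi>)))"
      by (simp add: boundary_def frag_extend_cmul)
    also have "\<dots> = (\<Sum>j\<in>?D - {i}. \<Sum>m\<in>{0..1}. g (i, l) (j, m))"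
      unfolding boundary_cube[OF c] dirs_dir_face[OF one that] frag_cmul_sum
      by (intro sum.cong refl) (auto simp: g_def mult_ac)
    also have "\<dots> = (\<Sum>j\<in>?D. \<Sum>m\<in>{0..1}. g (i, l) (j, m))"
      by (rule sum.mono_neutral_left) (use fin in \<open>auto simp: g_def\<close>)
    finally show ?thesis by (simp only: sum.cartesian_product case_prod_eta)
  qed
  have "boundary k \<Lambda> r (boundary k \<Lambda> (r + 1) (frag_of \<xi>)) = (\<Sum>i\<in>?D. \<Sum>l\<in>{0..1}. \<Sum>q\<in>?P. g (i, l) q)"
    unfolding boundary_cube[OF one] boundary_sum[OF fin] boundary_sum[OF finite_atLeastAtMost]
    by (intro sum.cong refl inner)
  also have "\<dots> = (\<Sum>p\<in>?P. \<Sum>q\<in>?P. g p q)"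
    by (simp only: sum.cartesian_product[of "\<lambda>l i. \<Sum>q\<in>?P. g (l, i) q"] case_prod_unfold prod.collapse)
  also have "\<dots> = 0"
  proof (rule antisymmetric_sum_zero)
    fix p q assume "p \<in> ?P" "q \<in> ?P"
    then show "g p q = - g q p"
    proof (cases "fst p = fst q")
      case False
      obtain i l j m where pq: "p = (i, l)" "q = (j, m)" by (metis surj_pair)
      have ij: "i \<in> ?D" "j \<in> ?D" "i \<noteq> j" using \<open>p \<in> ?P\<close> \<open>q \<in> ?P\<close> False pq by auto
      have "dir_sign ?D i * dir_sign (?D - {i}) j * (-1) ^ l * (-1) ^ m
          = - (dir_sign ?D j * dir_sign (?D - {j}) i * (-1) ^ m * (-1) ^ l)"
        unfolding dir_sign_swap[OF fin ij] by simp
      then show ?thesis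
        using ij by (simp add: pq g_def dir_face_commute[OF one ij])
    qed (simp add: g_def split_beta)
  qed (use fin in simp)
  finally show ?case .
qed (simp_all add: boundary_def frag_extend_diff)

end

section \<open>Homology classes\<close>

definition homology_class :: "nat \<Rightarrow> 'a kgraph_data \<Rightarrow> nat \<Rightarrow> ('a \<Rightarrow>\<^sub>0 int) \<Rightarrow> ('a \<Rightarrow>\<^sub>0 int) set" where
  "homology_class k \<Lambda> r c = (\<lambda>b. b + c) ` boundaries k \<Lambda> r"

lemma boundary_add: "boundary k \<Lambda> r (a + b) = boundary k \<Lambda> r a + boundary k \<Lambda> r b"
  and boundary_diff: "boundary k \<Lambda> r (a - b) = boundary k \<Lambda> r a - boundary k \<Lambda> r b"
  and boundary_minus: "boundary k \<Lambda> r (- a) = - boundary k \<Lambda> r a"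
  and boundary_cmul: "boundary k \<Lambda> r (frag_cmul n a) = frag_cmul n (boundary k \<Lambda> r a)"
  and boundary_zero: "boundary k \<Lambda> r 0 = 0"
  by (simp_all add: boundary_def frag_extend_add frag_extend_diff frag_extend_minus frag_extend_cmul)

lemma keys_add_subset:
  assumes "Poly_Mapping.keys a \<subseteq> S" "Poly_Mapping.keys b \<subseteq> S"
  shows "Poly_Mapping.keys (a + b) \<subseteq> S"
  using assms keys_add[of a b] by blast

lemma keys_diff_subset:
  assumes "Poly_Mapping.keys a \<subseteq> S" "Poly_Mapping.keys b \<subseteq> S"
  shows "Poly_Mapping.keys (a - b :: 'a \<Rightarrow>\<^sub>0 int) \<subseteq> S"
  using assms keys_diff[of a b] by blast

lemma keys_cmul_subset: "Poly_Mapping.keys c \<subseteq> S \<Longrightarrow> Poly_Mapping.keys (frag_cmul n c) \<subseteq> S"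
  using keys_cmul by blast

lemma cycles_iff: "z \<in> cycles k \<Lambda> r \<longleftrightarrow> Poly_Mapping.keys z \<subseteq> cubes k \<Lambda> r \<and> boundary k \<Lambda> r z = 0"
  by (simp add: cycles_def cube_chains_def kernel_def)

lemma boundaries_iff:
  "b \<in> boundaries k \<Lambda> r \<longleftrightarrow> (\<exists>c. Poly_Mapping.keys c \<subseteq> cubes k \<Lambda> (r + 1) \<and> b = boundary k \<Lambda> (r + 1) c)"
  unfolding boundaries_def cube_chains_def image_iff Bex_def carrier_free_Abelian_group_iff by (rule refl)

lemma cycles_closed:
  assumes "z \<in> cycles k \<Lambda> r"
  shows "w \<in> cycles k \<Lambda> r \<Longrightarrow> z + w \<in> cycles k \<Lambda> r" "w \<in> cycles k \<Lambda> r \<Longrightarrow> z - w \<in> cycles k \<Lambda> r"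
    "- z \<in> cycles k \<Lambda> r" "frag_cmul n z \<in> cycles k \<Lambda> r" "0 \<in> cycles k \<Lambda> r"
  using assms
  by (simp_all add: cycles_iff keys_add_subset keys_diff_subset keys_cmul_subset
      boundary_add boundary_diff boundary_minus boundary_cmul boundary_zero)

lemma zero_boundaries [simp]: "0 \<in> boundaries k \<Lambda> r"
  unfolding boundaries_iff by (rule exI[of _ 0]) (simp add: boundary_zero)

lemma boundaries_closed:
  assumes "z \<in> boundaries k \<Lambda> r"
  shows "w \<in> boundaries k \<Lambda> r \<Longrightarrow> z + w \<in> boundaries k \<Lambda> r"
    "w \<in> boundaries k \<Lambda> r \<Longrightarrow> z - w \<in> boundaries k \<Lambda> r"
    "- z \<in> boundaries k \<Lambda> r" "frag_cmul n z \<in> boundaries k \<Lambda> r"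
proof -
  obtain c where c: "Poly_Mapping.keys c \<subseteq> cubes k \<Lambda> (r + 1)" "z = boundary k \<Lambda> (r + 1) c"
    using assms unfolding boundaries_iff by blast
  show "z + w \<in> boundaries k \<Lambda> r" "z - w \<in> boundaries k \<Lambda> r" if w: "w \<in> boundaries k \<Lambda> r"
  proof -
    obtain d where d: "Poly_Mapping.keys d \<subseteq> cubes k \<Lambda> (r + 1)" "w = boundary k \<Lambda> (r + 1) d"
      using w unfolding boundaries_iff by blast
    show "z + w \<in> boundaries k \<Lambda> r"
      unfolding boundaries_iff c(2) d(2) boundary_add[symmetric] using keys_add_subset[OF c(1) d(1)] by blast
    show "z - w \<in> boundaries k \<Lambda> r"
      unfolding boundaries_iff c(2) d(2) boundary_diff[symmetric] using keys_diff_subset[OF c(1) d(1)] by blast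
  qed
  have cm: "frag_cmul n z \<in> boundaries k \<Lambda> r" for n
    unfolding boundaries_iff c(2) boundary_cmul[symmetric] using keys_cmul_subset[OF c(1)] by blast
  show "frag_cmul n z \<in> boundaries k \<Lambda> r" by (rule cm)
  show "- z \<in> boundaries k \<Lambda> r" using cm[of "-1"] by simp
qed

lemma homology_class_eq_iff:
  "homology_class k \<Lambda> r z = homology_class k \<Lambda> r w \<longleftrightarrow> z - w \<in> boundaries k \<Lambda> r"
proof
  assume "homology_class k \<Lambda> r z = homology_class k \<Lambda> r w"
  moreover have "z \<in> homology_class k \<Lambda> r z"
    unfolding homology_class_def image_iff by (rule bexI[of _ 0]) simp_all
  ultimately obtain b where "b \<in> boundaries k \<Lambda> r" "z = b + w"
    unfolding homology_class_def by auto
  then show "z - w \<in> boundaries k \<Lambda> r" by simp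
next
  assume zw: "z - w \<in> boundaries k \<Lambda> r"
  have "x \<in> homology_class k \<Lambda> r z \<longleftrightarrow> x \<in> homology_class k \<Lambda> r w" for x
  proof -
    have "x \<in> homology_class k \<Lambda> r u \<longleftrightarrow> x - u \<in> boundaries k \<Lambda> r" for u
      unfolding homology_class_def image_iff by (metis add_diff_cancel_right' diff_add_cancel)
    moreover have "x - w = (x - z) + (z - w)" "x - z = (x - w) - (z - w)" by simp_all
    ultimately show ?thesis using boundaries_closed(1,2) zw by metis
  qed
  then show "homology_class k \<Lambda> r z = homology_class k \<Lambda> r w" by blast
qed

text \<open>The set that defines the value on a class collapses to a single coset, because \<open>f\<close> maps boundaries
  to boundaries.\<close>

lemma homology_map_class:
  assumes "\<And>x y. f (x + y) = f x + f y"
    and "\<And>b. b \<in> boundaries k \<Lambda> r \<Longrightarrow> f b \<in> boundaries k' \<Lambda>' r'"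
  shows "homology_map k' \<Lambda>' r' f (homology_class k \<Lambda> r c) = homology_class k' \<Lambda>' r' (f c)"
proof (intro equalityI subsetI)
  fix x assume "x \<in> homology_map k' \<Lambda>' r' f (homology_class k \<Lambda> r c)"
  then obtain b' b where "b' \<in> boundaries k' \<Lambda>' r'" "b \<in> boundaries k \<Lambda> r" "x = b' + f (b + c)"
    unfolding homology_map_def set_mult_def homology_class_def cube_chains_def by auto
  then have "x = (b' + f b) + f c" "b' + f b \<in> boundaries k' \<Lambda>' r'"
    by (simp_all add: assms boundaries_closed(1) add.assoc)
  then show "x \<in> homology_class k' \<Lambda>' r' (f c)" unfolding homology_class_def by blast
next
  fix x assume "x \<in> homology_class k' \<Lambda>' r' (f c)"
  then obtain b' where "b' \<in> boundaries k' \<Lambda>' r'" "x = b' + f (0 + c)"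
    unfolding homology_class_def by auto
  then show "x \<in> homology_map k' \<Lambda>' r' f (homology_class k \<Lambda> r c)"
    unfolding homology_map_def set_mult_def homology_class_def cube_chains_def mult_free_Abelian_group
    using zero_boundaries[of k \<Lambda> r] by blast
qed

context k_graph
begin

lemma boundaries_subset_cycles: "boundaries k \<Lambda> r \<subseteq> cycles k \<Lambda> r"
proof
  fix b assume "b \<in> boundaries k \<Lambda> r"
  then obtain c where "Poly_Mapping.keys c \<subseteq> cubes k \<Lambda> (r + 1)" "b = boundary k \<Lambda> (r + 1) c"
    unfolding boundaries_iff by blast
  then show "b \<in> cycles k \<Lambda> r"
    using keys_boundary[of c "r + 1"] boundary_boundary[of c r] by (simp add: cycles_iff)
qed

lemma homology_carrier: "carrier (homology k \<Lambda> r) = homology_class k \<Lambda> r ` cycles k \<Lambda> r"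
proof -
  have "boundaries k \<Lambda> r #>\<^bsub>(cube_chains k \<Lambda> r)\<lparr>carrier := cycles k \<Lambda> r\<rparr>\<^esub> c = homology_class k \<Lambda> r c" for c
    by (auto simp: r_coset_def homology_class_def cube_chains_def)
  then show ?thesis by (simp add: homology_def carrier_FactGroup)
qed

lemma homology_comm_group: "comm_group (homology k \<Lambda> r)"
proof -
  have "comm_group ((cube_chains k \<Lambda> r)\<lparr>carrier := cycles k \<Lambda> r\<rparr>)" (is "comm_group ?Z")
  proof (rule comm_groupI)
    show "\<exists>y\<in>carrier ?Z. y \<otimes>\<^bsub>?Z\<^esub> z = \<one>\<^bsub>?Z\<^esub>" if "z \<in> carrier ?Z" for z
      by (rule bexI[of _ "- z"]) (use that in \<open>simp_all add: cube_chains_def cycles_closed(3)\<close>)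
  qed (auto simp: cube_chains_def add_ac cycles_closed(1) subsetD[OF boundaries_subset_cycles])
  then interpret Z: comm_group ?Z .
  have inv: "inv\<^bsub>?Z\<^esub> z = - z" if "z \<in> cycles k \<Lambda> r" for z
    by (rule Z.inv_equality) (use that cycles_closed in \<open>auto simp: cube_chains_def\<close>)
  have "subgroup (boundaries k \<Lambda> r) ?Z"
  proof (rule Z.subgroupI)
    show "inv\<^bsub>?Z\<^esub> b \<in> boundaries k \<Lambda> r" if "b \<in> boundaries k \<Lambda> r" for b
      using that subsetD[OF boundaries_subset_cycles that] inv boundaries_closed(3) by simp
    show "boundaries k \<Lambda> r \<noteq> {}" using zero_boundaries by blast
  qed (use boundaries_subset_cycles boundaries_closed(1) in \<open>auto simp: cube_chains_def\<close>)
  then show ?thesis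
    unfolding homology_def by (rule Z.abelian_FactGroup)
qed

lemma homology_group: "group (homology k \<Lambda> r)"
  using homology_comm_group comm_group.axioms(2) by blast

lemma homology_mult:
  "homology_class k \<Lambda> r z \<otimes>\<^bsub>homology k \<Lambda> r\<^esub> homology_class k \<Lambda> r w = homology_class k \<Lambda> r (z + w)"
proof (intro equalityI subsetI)
  fix x assume "x \<in> homology_class k \<Lambda> r z \<otimes>\<^bsub>homology k \<Lambda> r\<^esub> homology_class k \<Lambda> r w"
  then obtain b b' where "b \<in> boundaries k \<Lambda> r" "b' \<in> boundaries k \<Lambda> r" "x = (b + z) + (b' + w)"
    by (auto simp: homology_def set_mult_def homology_class_def cube_chains_def)
  then have "x = (b + b') + (z + w)" "b + b' \<in> boundaries k \<Lambda> r"
    using boundaries_closed(1) by (simp_all add: add_ac)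
  then show "x \<in> homology_class k \<Lambda> r (z + w)" unfolding homology_class_def by blast
next
  fix x assume "x \<in> homology_class k \<Lambda> r (z + w)"
  then obtain b where "b \<in> boundaries k \<Lambda> r" "x = (b + z) + (0 + w)"
    by (auto simp: homology_class_def add.assoc)
  then show "x \<in> homology_class k \<Lambda> r z \<otimes>\<^bsub>homology k \<Lambda> r\<^esub> homology_class k \<Lambda> r w"
    using zero_boundaries[of k \<Lambda> r]
    by (force simp: homology_def set_mult_def homology_class_def cube_chains_def)
qed

lemma homology_one: "\<one>\<^bsub>homology k \<Lambda> r\<^esub> = homology_class k \<Lambda> r 0"
  by (simp add: homology_def homology_class_def)

lemma homology_class_eq_one_iff:
  "homology_class k \<Lambda> r z = \<one>\<^bsub>homology k \<Lambda> r\<^esub> \<longleftrightarrow> z \<in> boundaries k \<Lambda> r"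
  by (simp add: homology_one homology_class_eq_iff)

lemma homology_inv:
  assumes "z \<in> cycles k \<Lambda> r"
  shows "inv\<^bsub>homology k \<Lambda> r\<^esub> homology_class k \<Lambda> r z = homology_class k \<Lambda> r (- z)"
  by (rule group.inv_equality[OF homology_group])
     (use assms in \<open>auto simp: homology_mult homology_one homology_carrier cycles_closed(3)\<close>)

end

lemma group_hom_homologyI:
  assumes "k_graph k \<Lambda>" "k_graph k' \<Lambda>'"
    and add: "\<And>x y. f (x + y) = f x + f y"
    and cyc: "\<And>z. z \<in> cycles k \<Lambda> r \<Longrightarrow> f z \<in> cycles k' \<Lambda>' r'"
    and F: "\<And>z. z \<in> cycles k \<Lambda> r \<Longrightarrow> F (homology_class k \<Lambda> r z) = homology_class k' \<Lambda>' r' (f z)"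
  shows "group_hom (homology k \<Lambda> r) (homology k' \<Lambda>' r') F"
proof -
  interpret L: k_graph k \<Lambda> by fact
  interpret L': k_graph k' \<Lambda>' by fact
  have "F \<in> hom (homology k \<Lambda> r) (homology k' \<Lambda>' r')"
    unfolding hom_def L.homology_carrier L'.homology_carrier
    using cyc by (auto simp: L.homology_mult L'.homology_mult F cycles_closed(1) add)
  then show ?thesis
    using L.homology_group L'.homology_group by (simp add: group_hom_def group_hom_axioms_def)
qed

text \<open>Exactness on the level of homology, for maps induced by maps of cycles, reduces to a chase with
  representatives.\<close>

lemma exact_at_homologyI:
  assumes "k_graph k1 \<Lambda>1" "k_graph k2 \<Lambda>2" "k_graph k3 \<Lambda>3"
    and "group_hom (homology k1 \<Lambda>1 r1) (homology k2 \<Lambda>2 r2) f" "group_hom (homology k2 \<Lambda>2 r2) (homology k3 \<Lambda>3 r3) g"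
    and f: "\<And>z. z \<in> cycles k1 \<Lambda>1 r1 \<Longrightarrow> f (homology_class k1 \<Lambda>1 r1 z) = homology_class k2 \<Lambda>2 r2 (f' z)"
    and g: "\<And>z. z \<in> cycles k2 \<Lambda>2 r2 \<Longrightarrow> g (homology_class k2 \<Lambda>2 r2 z) = homology_class k3 \<Lambda>3 r3 (g' z)"
    and f': "\<And>z. z \<in> cycles k1 \<Lambda>1 r1 \<Longrightarrow> f' z \<in> cycles k2 \<Lambda>2 r2"
    and gf: "\<And>z. z \<in> cycles k1 \<Lambda>1 r1 \<Longrightarrow> g' (f' z) \<in> boundaries k3 \<Lambda>3 r3"
    and ex: "\<And>z. z \<in> cycles k2 \<Lambda>2 r2 \<Longrightarrow> g' z \<in> boundaries k3 \<Lambda>3 r3 \<Longrightarrow>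
      \<exists>w\<in>cycles k1 \<Lambda>1 r1. z - f' w \<in> boundaries k2 \<Lambda>2 r2"
  shows "exact_at (homology k1 \<Lambda>1 r1) f (homology k2 \<Lambda>2 r2) g (homology k3 \<Lambda>3 r3)"
proof -
  interpret L1: k_graph k1 \<Lambda>1 by fact
  interpret L2: k_graph k2 \<Lambda>2 by fact
  interpret L3: k_graph k3 \<Lambda>3 by fact
  have "f ` carrier (homology k1 \<Lambda>1 r1) = (\<lambda>z. homology_class k2 \<Lambda>2 r2 (f' z)) ` cycles k1 \<Lambda>1 r1"
    unfolding L1.homology_carrier image_image using f by (rule image_cong[OF refl])
  moreover have "g (homology_class k2 \<Lambda>2 r2 z) = \<one>\<^bsub>homology k3 \<Lambda>3 r3\<^esub> \<longleftrightarrow> g' z \<in> boundaries k3 \<Lambda>3 r3"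
    if "z \<in> cycles k2 \<Lambda>2 r2" for z
    unfolding g[OF that] by (rule L3.homology_class_eq_one_iff)
  then have "kernel (homology k2 \<Lambda>2 r2) (homology k3 \<Lambda>3 r3) g =
      homology_class k2 \<Lambda>2 r2 ` {z \<in> cycles k2 \<Lambda>2 r2. g' z \<in> boundaries k3 \<Lambda>3 r3}"
    unfolding kernel_def L2.homology_carrier by blast
  moreover have "(\<lambda>z. homology_class k2 \<Lambda>2 r2 (f' z)) ` cycles k1 \<Lambda>1 r1 =
      homology_class k2 \<Lambda>2 r2 ` {z \<in> cycles k2 \<Lambda>2 r2. g' z \<in> boundaries k3 \<Lambda>3 r3}"
  proof (intro equalityI subsetI)
    fix x assume "x \<in> homology_class k2 \<Lambda>2 r2 ` {z \<in> cycles k2 \<Lambda>2 r2. g' z \<in> boundaries k3 \<Lambda>3 r3}"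
    then obtain z w where "x = homology_class k2 \<Lambda>2 r2 z" "w \<in> cycles k1 \<Lambda>1 r1" "z - f' w \<in> boundaries k2 \<Lambda>2 r2"
      using ex by blast
    then show "x \<in> (\<lambda>z. homology_class k2 \<Lambda>2 r2 (f' z)) ` cycles k1 \<Lambda>1 r1"
      using homology_class_eq_iff by blast
  qed (use f' gf in blast)
  ultimately show ?thesis
    using assms(4,5) unfolding exact_at_def by simp
qed

section \<open>Chain maps of the crossed product\<close>

abbreviation push :: "('a \<Rightarrow> 'b) \<Rightarrow> ('a \<Rightarrow>\<^sub>0 int) \<Rightarrow> ('b \<Rightarrow>\<^sub>0 int)" where
  "push \<phi> \<equiv> frag_extend (\<lambda>\<xi>. frag_of (\<phi> \<xi>))"

definition layer :: "nat \<Rightarrow> ('a \<times> nat \<Rightarrow>\<^sub>0 int) \<Rightarrow> ('a \<Rightarrow>\<^sub>0 int)" where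
  "layer m = frag_extend (\<lambda>(\<xi>, n). if n = m then frag_of \<xi> else 0)"

lemma push_push: "push \<phi> (push \<psi> c) = push (\<lambda>\<xi>. \<phi> (\<psi> \<xi>)) c"
  using frag_extend_compose[of "\<lambda>\<xi>. frag_of (\<phi> \<xi>)" \<psi> c] by (simp add: comp_def)

lemma push_id:
  assumes "Poly_Mapping.keys c \<subseteq> S" "\<And>\<xi>. \<xi> \<in> S \<Longrightarrow> \<phi> \<xi> = \<xi>"
  shows "push \<phi> c = c"
proof -
  have "push \<phi> c = frag_extend frag_of c"
    by (rule frag_extend_eq) (use assms in auto)
  then show ?thesis using frag_expansion[of c] by simp
qed

lemma keys_push:
  assumes "Poly_Mapping.keys c \<subseteq> S" "\<And>\<xi>. \<xi> \<in> S \<Longrightarrow> \<phi> \<xi> \<in> T"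
  shows "Poly_Mapping.keys (push \<phi> c) \<subseteq> T"
proof -
  have "(\<Union>\<xi>\<in>Poly_Mapping.keys c. Poly_Mapping.keys (frag_of (\<phi> \<xi>))) \<subseteq> T"
    using assms by (auto simp: keys_frag_of)
  then show ?thesis by (rule order_trans[OF keys_frag_extend])
qed

lemma layer_push: "layer m (push (\<lambda>\<xi>. (\<xi>, n)) c) = (if n = m then c else 0)"
proof -
  have "layer m (push (\<lambda>\<xi>. (\<xi>, n)) c) = frag_extend (\<lambda>\<xi>. if n = m then frag_of \<xi> else 0) c"
    unfolding layer_def
    using frag_extend_compose[of "\<lambda>(\<xi>, n). if n = m then frag_of \<xi> else 0" "\<lambda>\<xi>. (\<xi>, n)" c]
    by (simp add: comp_def)
  then show ?thesis using frag_expansion[of c] by (simp add: frag_extend_eq_0)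
qed

lemma layer_add: "layer m (a + b) = layer m a + layer m b"
  and layer_zero: "layer m 0 = 0"
  by (simp_all add: layer_def frag_extend_add)

text \<open>The signs in the boundary depend only on the set of directions of a cube, so a map of cubes that
  respects directions and faces is a chain map.\<close>

lemma boundary_push:
  assumes "k_graph k \<Lambda>" "k_graph k' \<Lambda>'"
    and c: "Poly_Mapping.keys c \<subseteq> cubes k \<Lambda> r"
    and cube: "\<And>\<xi>. \<xi> \<in> cubes k \<Lambda> r \<Longrightarrow> \<phi> \<xi> \<in> cubes k' \<Lambda>' r"
    and dirs: "\<And>\<xi>. \<xi> \<in> cubes k \<Lambda> r \<Longrightarrow> dirs \<Lambda>' (\<phi> \<xi>) = dirs \<Lambda> \<xi>"
    and face: "\<And>\<xi> i l. \<xi> \<in> cubes k \<Lambda> r \<Longrightarrow> i \<in> dirs \<Lambda> \<xi> \<Longrightarrow> dir_face \<Lambda>' l i (\<phi> \<xi>) = \<phi> (dir_face \<Lambda> l i \<xi>)"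
  shows "boundary k' \<Lambda>' r (push \<phi> c) = push \<phi> (boundary k \<Lambda> r c)"
  using c
proof (induction c rule: frag_induction)
  case (one \<xi>)
  interpret L: k_graph k \<Lambda> by fact
  interpret L': k_graph k' \<Lambda>' by fact
  have fin: "finite (dirs \<Lambda> \<xi>)" using one L.finite_dirs by (simp add: cubes_def)
  show ?case
    unfolding frag_extend_of L.boundary_cube[OF one] L'.boundary_cube[OF cube[OF one]] dirs[OF one]
      frag_extend_sum[OF fin] frag_extend_sum[OF finite_atLeastAtMost] comp_def frag_extend_cmul
    by (intro sum.cong refl) (simp only: face[OF one])
qed (simp_all add: boundary_zero boundary_diff frag_extend_diff)

locale k_graph_automorphism = k_graph k \<Lambda>
  for k and \<Lambda> :: "'a kgraph_data" (structure) +
  fixes \<alpha> :: "'a \<Rightarrow> 'a"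
  assumes automorphism: "kgraph_automorphism \<Lambda> \<alpha>"
begin

abbreviation "X \<equiv> crossed_product k \<Lambda> \<alpha>"

abbreviation "\<alpha>' \<equiv> inv_into (arrows \<Lambda>) \<alpha>"

sublocale X: k_graph "k + 1" X
  by (rule k_graph_crossed_product[OF k_graph_axioms automorphism])

lemma functor_\<alpha>: "degree_functor \<Lambda> \<alpha>" and functor_\<alpha>': "degree_functor \<Lambda> \<alpha>'"
  and \<alpha>'_\<alpha>: "\<xi> \<in> arrows \<Lambda> \<Longrightarrow> \<alpha>' (\<alpha> \<xi>) = \<xi>" and \<alpha>_\<alpha>': "\<xi> \<in> arrows \<Lambda> \<Longrightarrow> \<alpha> (\<alpha>' \<xi>) = \<xi>"
  using automorphism automorphism_inv[OF automorphism k_graph_axioms]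
  by (simp_all add: kgraph_automorphism_def)

lemma functor_cube:
  assumes "degree_functor \<Lambda> \<phi>" "\<xi> \<in> cubes k \<Lambda> r"
  shows "\<phi> \<xi> \<in> cubes k \<Lambda> r" "dirs \<Lambda> (\<phi> \<xi>) = dirs \<Lambda> \<xi>"
  using assms by (simp_all add: cubes_def degree_functor_def dirs_def)

text \<open>A degree-preserving functor carries a factorisation to a factorisation of the same shape.\<close>

lemma functor_dir_face:
  assumes F: "degree_functor \<Lambda> \<phi>" and x: "\<xi> \<in> arrows \<Lambda>" "i \<in> dirs \<Lambda> \<xi>"
  shows "dir_face \<Lambda> l i (\<phi> \<xi>) = \<phi> (dir_face \<Lambda> l i \<xi>)"
proof -
  obtain \<mu> \<eta> \<nu> where h: "\<mu> \<in> arrows \<Lambda>" "\<eta> \<in> arrows \<Lambda>" "\<nu> \<in> arrows \<Lambda>"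
    "src \<Lambda> \<mu> = rg \<Lambda> \<eta>" "src \<Lambda> \<eta> = rg \<Lambda> \<nu>"
    "dg \<Lambda> \<mu> = (if l = 0 then 0 else gen i)" "dg \<Lambda> \<eta> = dg \<Lambda> \<xi> - gen i" "\<xi> = \<mu> \<cdot> (\<eta> \<cdot> \<nu>)"
    "segment \<Lambda> (if l = 0 then 0 else gen i) (dg \<Lambda> \<xi> - gen i) \<xi> = \<eta>"
    by (rule segment_ex[OF x(1) dir_face_start_le[OF x(2)]])
  have "dg \<Lambda> (\<phi> \<xi>) = dg \<Lambda> \<xi>" using F x by (simp add: degree_functor_def)
  moreover have "segment \<Lambda> (if l = 0 then 0 else gen i) (dg \<Lambda> \<xi> - gen i) (\<phi> \<xi>) = \<phi> \<eta>"
  proof (rule segment_eqI[of "\<phi> \<mu>" _ "\<phi> \<nu>"])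
    have "\<phi> \<xi> = \<phi> \<mu> \<cdot> \<phi> (\<eta> \<cdot> \<nu>)"
      using F h by (simp add: degree_functor_def cmp_arrow rg_cmp)
    also have "\<phi> (\<eta> \<cdot> \<nu>) = \<phi> \<eta> \<cdot> \<phi> \<nu>"
      using F h by (simp add: degree_functor_def)
    finally show "\<phi> \<xi> = \<phi> \<mu> \<cdot> (\<phi> \<eta> \<cdot> \<phi> \<nu>)" .
  qed (use F h(1-7) in \<open>simp_all add: degree_functor_def\<close>)
  ultimately show ?thesis
    unfolding dir_face_def using h(9) by simp
qed

lemma boundary_functor:
  assumes "degree_functor \<Lambda> \<phi>" "Poly_Mapping.keys c \<subseteq> cubes k \<Lambda> r"
  shows "boundary k \<Lambda> r (push \<phi> c) = push \<phi> (boundary k \<Lambda> r c)"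
  by (rule boundary_push[OF k_graph_axioms k_graph_axioms assms(2) functor_cube[OF assms(1)]])
     (use functor_dir_face[OF assms(1)] in \<open>simp_all add: cubes_def\<close>)

lemma X_simps:
  "arrows X = arrows \<Lambda> \<times> UNIV" "rg X (\<xi>, m) = (rg \<Lambda> \<xi>, 0)"
  "src X (\<xi>, m) = ((\<alpha>' ^^ m) (src \<Lambda> \<xi>), 0)" "(\<xi>, m) \<cdot>\<^bsub>X\<^esub> (\<mu>, n) = (\<xi> \<cdot> (\<alpha> ^^ m) \<mu>, m + n)"
  "dg X (\<xi>, m) = (dg \<Lambda> \<xi>)(Suc k := m)"
  by (simp_all add: crossed_product_def)

lemma new_dir_notin: "\<xi> \<in> arrows \<Lambda> \<Longrightarrow> Suc k \<notin> dirs \<Lambda> \<xi>"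
  using dirs_subset by fastforce

lemma dirs_X:
  assumes "\<xi> \<in> arrows \<Lambda>"
  shows "dirs X (\<xi>, m) = (if m = 0 then dirs \<Lambda> \<xi> else insert (Suc k) (dirs \<Lambda> \<xi>))"
  using new_dir_notin[OF assms] unfolding dirs_def X_simps by auto

lemma cubes_X:
  "(\<xi>, m) \<in> cubes (k + 1) X r \<longleftrightarrow>
     (m = 0 \<and> \<xi> \<in> cubes k \<Lambda> r) \<or> (m = 1 \<and> r > 0 \<and> \<xi> \<in> cubes k \<Lambda> (r - 1))"
proof (cases "\<xi> \<in> arrows \<Lambda>")
  case True
  have z: "dg \<Lambda> \<xi> (Suc k) = 0" using new_dir_notin[OF True] by (simp add: dirs_def)
  have "(\<forall>i. ((dg \<Lambda> \<xi>)(Suc k := m)) i \<le> 1) \<longleftrightarrow> m \<le> 1 \<and> (\<forall>i. dg \<Lambda> \<xi> i \<le> 1)"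
    using z by (metis fun_upd_apply zero_le)
  moreover have "card (dirs X (\<xi>, m)) = (if m = 0 then card (dirs \<Lambda> \<xi>) else Suc (card (dirs \<Lambda> \<xi>)))"
    using new_dir_notin[OF True] finite_dirs[OF True] by (simp add: dirs_X[OF True])
  ultimately have "(\<xi>, m) \<in> cubes (k + 1) X r \<longleftrightarrow> m \<le> 1 \<and> (\<forall>i. dg \<Lambda> \<xi> i \<le> 1)
      \<and> (if m = 0 then card (dirs \<Lambda> \<xi>) else Suc (card (dirs \<Lambda> \<xi>))) = r"
    unfolding X.cubes_iff X_simps using True by simp
  also have "\<dots> \<longleftrightarrow> (m = 0 \<and> \<xi> \<in> cubes k \<Lambda> r) \<or> (m = 1 \<and> r > 0 \<and> \<xi> \<in> cubes k \<Lambda> (r - 1))"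
    unfolding cubes_iff using True by (cases m) auto
  finally show ?thesis .
qed (simp add: cubes_def X_simps)

text \<open>A factor \<open>\<nu>\<close> that is split off at the end of \<open>\<xi> = \<mu> \<cdot> \<nu>\<close> has to pass the \<open>m\<close> new edges of
  \<open>(\<xi>, m)\<close>, which twists it by \<open>\<alpha>\<^sup>-\<^sup>m\<close>; the remaining face \<open>\<mu>\<close> is not affected.\<close>

lemma dir_face_X:
  assumes x: "\<xi> \<in> arrows \<Lambda>" "i \<in> dirs \<Lambda> \<xi>"
  shows "dir_face X l i (\<xi>, m) = (dir_face \<Lambda> l i \<xi>, m)"
proof -
  have ik: "i \<noteq> Suc k" using new_dir_notin x by blast
  note N = edge_Nk[OF x]
  have new: "dg \<Lambda> \<nu> (Suc k) = 0" if "\<nu> \<in> arrows \<Lambda>" for \<nu>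
    using new_dir_notin[OF that] by (simp add: dirs_def)
  show ?thesis
  proof (cases "l = 0")
    case True
    obtain \<mu> \<nu> where f: "\<mu> \<in> arrows \<Lambda>" "\<nu> \<in> arrows \<Lambda>" "dg \<Lambda> \<mu> = dg \<Lambda> \<xi> - gen i" "dg \<Lambda> \<nu> = gen i"
      "src \<Lambda> \<mu> = rg \<Lambda> \<nu>" "\<xi> = \<mu> \<cdot> \<nu>"
      by (rule factor_ex[OF x(1) N(2,1)]) (use gen_le[OF x(2)] in \<open>simp add: add.commute\<close>)
    let ?\<nu> = "(\<alpha>' ^^ m) \<nu>"
    have n: "?\<nu> \<in> arrows \<Lambda>" "dg \<Lambda> ?\<nu> = gen i" "rg \<Lambda> ?\<nu> = (\<alpha>' ^^ m) (rg \<Lambda> \<nu>)" "(\<alpha> ^^ m) ?\<nu> = \<nu>"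
      using degree_functor_funpow[OF functor_\<alpha>', of m] f
        funpow_inverse[OF functor_\<alpha> functor_\<alpha>' \<alpha>_\<alpha>' f(2), of m]
      by (simp_all add: degree_functor_def)
    have "dir_face X 0 i (\<xi>, m) = (\<mu>, m)"
      by (rule X.dir_face_eqI(1)[of _ "(?\<nu>, 0)"]) (use f n ik new in \<open>auto simp: X_simps fun_eq_iff gen_def\<close>)
    moreover have "dir_face \<Lambda> 0 i \<xi> = \<mu>" by (rule dir_face_eqI(1)) (use f in auto)
    ultimately show ?thesis using True by simp
  next
    case False
    obtain \<mu> \<nu> where f: "\<mu> \<in> arrows \<Lambda>" "\<nu> \<in> arrows \<Lambda>" "dg \<Lambda> \<mu> = gen i" "dg \<Lambda> \<nu> = dg \<Lambda> \<xi> - gen i"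
      "src \<Lambda> \<mu> = rg \<Lambda> \<nu>" "\<xi> = \<mu> \<cdot> \<nu>"
      by (rule factor_ex[OF x(1) N]) (use gen_le[OF x(2)] in simp)
    have "dir_face X l i (\<xi>, m) = (\<nu>, m)"
      by (rule X.dir_face_eqI(2)[of "(\<mu>, 0)"]) (use f ik False in \<open>auto simp: X_simps fun_eq_iff gen_def\<close>)
    moreover have "dir_face \<Lambda> l i \<xi> = \<nu>" by (rule dir_face_eqI(2)) (use f False in auto)
    ultimately show ?thesis by simp
  qed
qed

text \<open>The crossed product is the mapping torus of \<open>\<alpha>\<close>. The prism \<open>(\<xi>, 1)\<close> over the cube \<open>\<xi>\<close> runs from
  \<open>\<xi>\<close> to its translate: \<open>(\<xi>, 0) \<cdot> (s(\<xi>), 1) = (\<xi>, 1) = (r(\<xi>), 1) \<cdot> (\<alpha>\<inverse>(\<xi>), 0)\<close>.\<close>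

lemma new_dir_face:
  assumes x: "\<xi> \<in> arrows \<Lambda>"
  shows "dir_face X 0 (Suc k) (\<xi>, 1) = (\<xi>, 0)"
    and "l \<noteq> 0 \<Longrightarrow> dir_face X l (Suc k) (\<xi>, 1) = (\<alpha>' \<xi>, 0)"
proof -
  show "dir_face X 0 (Suc k) (\<xi>, 1) = (\<xi>, 0)"
    by (rule X.dir_face_eqI(1)[of _ "(src \<Lambda> \<xi>, 1)"])
       (use x in \<open>auto simp: X_simps src_arrow rg_src cmp_id_right dg_src fun_eq_iff gen_def\<close>)
  have a: "\<alpha>' \<xi> \<in> arrows \<Lambda>" "rg \<Lambda> (\<alpha>' \<xi>) = \<alpha>' (rg \<Lambda> \<xi>)"
    using functor_\<alpha>' x by (simp_all add: degree_functor_def)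
  show "dir_face X l (Suc k) (\<xi>, 1) = (\<alpha>' \<xi>, 0)" if "l \<noteq> 0"
    by (rule X.dir_face_eqI(2)[of "(rg \<Lambda> \<xi>, 1)", OF _ _ _ _ _ that])
       (use x a in \<open>auto simp: X_simps rg_arrow src_rg cmp_id_left dg_rg \<alpha>_\<alpha>' fun_eq_iff gen_def\<close>)
qed

lemma boundary_base:
  assumes "Poly_Mapping.keys c \<subseteq> cubes k \<Lambda> r"
  shows "boundary (k + 1) X r (push (\<lambda>\<xi>. (\<xi>, 0)) c) = push (\<lambda>\<xi>. (\<xi>, 0)) (boundary k \<Lambda> r c)"
proof (rule boundary_push[OF k_graph_axioms X.k_graph_axioms assms])
  fix \<xi> assume "\<xi> \<in> cubes k \<Lambda> r"
  then have "\<xi> \<in> arrows \<Lambda>" by (simp add: cubes_def)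
  then show "dirs X (\<xi>, 0) = dirs \<Lambda> \<xi>" "\<And>i l. i \<in> dirs \<Lambda> \<xi> \<Longrightarrow> dir_face X l i (\<xi>, 0) = (dir_face \<Lambda> l i \<xi>, 0)"
    using dirs_X dir_face_X by simp_all
  show "(\<xi>, 0) \<in> cubes (k + 1) X r" using \<open>\<xi> \<in> cubes k \<Lambda> r\<close> unfolding cubes_X by simp
qed

text \<open>The new direction is the last one, so it leaves the signs of the old directions unchanged and
  itself has sign \<open>(-1)\<^sup>r\<^sup>+\<^sup>1\<close>. Up to signs this exhibits the chains of the crossed product as the mapping
  cone of \<open>1 - \<alpha>\<inverse>\<close> on the chains of \<open>\<Lambda>\<close>.\<close>

lemma boundary_prism:
  assumes "Poly_Mapping.keys c \<subseteq> cubes k \<Lambda> r"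
  shows "boundary (k + 1) X (r + 1) (push (\<lambda>\<xi>. (\<xi>, 1)) c) =
     push (\<lambda>\<xi>. (\<xi>, 1)) (boundary k \<Lambda> r c) + frag_cmul ((-1) ^ (r + 1)) (push (\<lambda>\<xi>. (\<xi>, 0)) (c - push \<alpha>' c))"
  using assms
proof (induction c rule: frag_induction)
  case (one \<xi>)
  let ?D = "dirs \<Lambda> \<xi>"
  have x: "\<xi> \<in> arrows \<Lambda>" "card ?D = r" using one unfolding cubes_iff by blast+
  have fin: "finite ?D" and new: "Suc k \<notin> ?D" and le: "?D \<subseteq> {1..k}"
    using finite_dirs new_dir_notin dirs_subset x(1) by blast+
  have cube: "(\<xi>, 1) \<in> cubes (k + 1) X (r + 1)" using one unfolding cubes_X by simp
  have D: "dirs X (\<xi>, 1) = insert (Suc k) ?D" by (simp add: dirs_X[OF x(1)])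
  have "{j \<in> insert (Suc k) ?D. j \<le> Suc k} = insert (Suc k) ?D" using le by auto
  then have top_sign: "dir_sign (insert (Suc k) ?D) (Suc k) = (-1) ^ (r + 1)"
    using x(2) fin new by (simp add: dir_sign_def)
  have old_sign: "dir_sign (insert (Suc k) ?D) i = dir_sign ?D i" if "i \<in> ?D" for i
  proof -
    have "{j \<in> insert (Suc k) ?D. j \<le> i} = {j \<in> ?D. j \<le> i}" using le that by auto
    then show ?thesis by (simp only: dir_sign_def)
  qed
  let ?t = "\<lambda>i l. frag_cmul (dir_sign (insert (Suc k) ?D) i * (-1) ^ l) (frag_of (dir_face X l i (\<xi>, 1)))"
  have "boundary (k + 1) X (r + 1) (frag_of (\<xi>, 1)) = (\<Sum>l\<in>{0..1}. ?t (Suc k) l) + (\<Sum>i\<in>?D. \<Sum>l\<in>{0..1}. ?t i l)"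
    unfolding X.boundary_cube[OF cube] D by (rule sum.insert[OF fin new])
  also have "(\<Sum>l\<in>{0..1}. ?t (Suc k) l) = frag_cmul ((-1) ^ (r + 1)) (frag_of (\<xi>, 0) - frag_of (\<alpha>' \<xi>, 0))"
  proof -
    have "{0..1::nat} = {0, 1}" by auto
    then have "(\<Sum>l\<in>{0..1}. ?t (Suc k) l) = ?t (Suc k) 0 + ?t (Suc k) 1" by simp
    also have "\<dots> = frag_cmul ((-1) ^ (r + 1)) (frag_of (\<xi>, 0) - frag_of (\<alpha>' \<xi>, 0))"
      unfolding top_sign new_dir_face(1)[OF x(1)] new_dir_face(2)[OF x(1) one_neq_zero]
      by (rule poly_mapping_eqI) (simp add: lookup_add lookup_minus algebra_simps)
    finally show ?thesis .
  qed
  also have "(\<Sum>i\<in>?D. \<Sum>l\<in>{0..1}. ?t i l) = push (\<lambda>\<xi>. (\<xi>, 1)) (boundary k \<Lambda> r (frag_of \<xi>))"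
    unfolding boundary_cube[OF one] frag_extend_sum[OF fin] frag_extend_sum[OF finite_atLeastAtMost]
      comp_def frag_extend_cmul frag_extend_of
    by (intro sum.cong refl) (simp only: old_sign dir_face_X[OF x(1)])
  finally show ?case by (simp only: frag_extend_of frag_extend_diff add.commute)
next
  case (diff a b)
  then show ?case
    by (simp add: boundary_diff frag_extend_diff)
       (rule poly_mapping_eqI, simp add: lookup_add lookup_minus algebra_simps)
qed (simp_all add: boundary_zero)

lemma chain_X_decompose:
  assumes "Poly_Mapping.keys c \<subseteq> cubes (k + 1) X (r + 1)"
  obtains a b where "Poly_Mapping.keys a \<subseteq> cubes k \<Lambda> (r + 1)" "Poly_Mapping.keys b \<subseteq> cubes k \<Lambda> r"
    "c = push (\<lambda>\<xi>. (\<xi>, 0)) a + push (\<lambda>\<xi>. (\<xi>, 1)) b"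
proof -
  have "\<exists>a b. Poly_Mapping.keys a \<subseteq> cubes k \<Lambda> (r + 1) \<and> Poly_Mapping.keys b \<subseteq> cubes k \<Lambda> r \<and>
    c = push (\<lambda>\<xi>. (\<xi>, 0)) a + push (\<lambda>\<xi>. (\<xi>, 1)) b"
    using assms
  proof (induction c rule: frag_induction)
    case zero
    show ?case by (rule exI[of _ 0], rule exI[of _ 0]) simp
  next
    case (one x)
    obtain \<xi> m where xm: "x = (\<xi>, m)" by (cases x)
    consider "m = 0" "\<xi> \<in> cubes k \<Lambda> (r + 1)" | "m = 1" "\<xi> \<in> cubes k \<Lambda> r"
      using one unfolding xm cubes_X by auto
    then show ?case
    proof cases
      case 1
      then show ?thesis by (intro exI[of _ "frag_of \<xi>"] exI[of _ 0]) (simp add: xm keys_frag_of)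
    next
      case 2
      then show ?thesis by (intro exI[of _ 0] exI[of _ "frag_of \<xi>"]) (simp add: xm keys_frag_of)
    qed
  next
    case (diff c d)
    then obtain a b a' b' where
      "Poly_Mapping.keys a \<subseteq> cubes k \<Lambda> (r + 1)" "Poly_Mapping.keys b \<subseteq> cubes k \<Lambda> r"
      "c = push (\<lambda>\<xi>. (\<xi>, 0)) a + push (\<lambda>\<xi>. (\<xi>, 1)) b"
      "Poly_Mapping.keys a' \<subseteq> cubes k \<Lambda> (r + 1)" "Poly_Mapping.keys b' \<subseteq> cubes k \<Lambda> r"
      "d = push (\<lambda>\<xi>. (\<xi>, 0)) a' + push (\<lambda>\<xi>. (\<xi>, 1)) b'"
      by blast
    then show ?case
      by (intro exI[of _ "a - a'"] exI[of _ "b - b'"]) (simp add: keys_diff_subset frag_extend_diff)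
  qed
  then show thesis using that by blast
qed

text \<open>In degree 0 there are no prisms, which is why \<open>\<iota>\<^sub>*\<close> is onto there.\<close>

lemma chain_X_0_decompose:
  assumes "Poly_Mapping.keys c \<subseteq> cubes (k + 1) X 0"
  obtains a where "Poly_Mapping.keys a \<subseteq> cubes k \<Lambda> 0" "c = push (\<lambda>\<xi>. (\<xi>, 0)) a"
proof -
  have "\<exists>a. Poly_Mapping.keys a \<subseteq> cubes k \<Lambda> 0 \<and> c = push (\<lambda>\<xi>. (\<xi>, 0)) a"
    using assms
  proof (induction c rule: frag_induction)
    case (one x)
    obtain \<xi> m where xm: "x = (\<xi>, m)" by (cases x)
    have "m = 0" "\<xi> \<in> cubes k \<Lambda> 0"
      using one unfolding xm cubes_X by auto
    then show ?case by (intro exI[of _ "frag_of \<xi>"]) (simp add: xm keys_frag_of)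
  next
    case (diff c d)
    then obtain a a' where
      "Poly_Mapping.keys a \<subseteq> cubes k \<Lambda> 0" "c = push (\<lambda>\<xi>. (\<xi>, 0)) a"
      "Poly_Mapping.keys a' \<subseteq> cubes k \<Lambda> 0" "d = push (\<lambda>\<xi>. (\<xi>, 0)) a'"
      by blast
    then show ?case
      by (intro exI[of _ "a - a'"]) (simp add: keys_diff_subset frag_extend_diff)
  qed (auto intro: exI[of _ 0])
  then show thesis using that by blast
qed

end

section \<open>Exactness of the Wang sequence\<close>

lemma pi_star_eq: "pi_star k \<Lambda> r = homology_map k \<Lambda> r (\<lambda>c. frag_cmul ((-1) ^ r) (layer 1 c))"
proof -
  have "frag_extend (\<lambda>(\<xi>, n). if n = 1 then frag_cmul ((-1) ^ r) (frag_of \<xi>) else 0) c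
      = frag_cmul ((-1) ^ r) (layer 1 c)" for c :: "'a \<times> nat \<Rightarrow>\<^sub>0 int"
    unfolding layer_def frag_extend_def frag_cmul_sum
    by (intro sum.cong refl) (auto simp: mult.commute)
  then show ?thesis unfolding pi_star_def by presburger
qed

lemma frag_cmul_diff: "frag_cmul n (a - b) = frag_cmul n a - frag_cmul n b"
  by (rule poly_mapping_eqI) (simp add: lookup_minus right_diff_distrib)

lemma frag_cmul_minus: "frag_cmul n (- a) = - frag_cmul n a"
  by (rule poly_mapping_eqI) simp

lemma group_hom_zero:
  "group G \<Longrightarrow> group_hom zero_group G (\<lambda>_. \<one>\<^bsub>G\<^esub>)" "group G \<Longrightarrow> group_hom G zero_group (\<lambda>_. ())"
  by (auto simp: group_hom_def group_hom_axioms_def hom_def group.is_monoid singleton_group_def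
      intro: singleton_group[unfolded singleton_group_def])

context k_graph_automorphism
begin

abbreviation "base \<equiv> push (\<lambda>\<xi>. (\<xi>, 0 :: nat))"
abbreviation "prism \<equiv> push (\<lambda>\<xi>. (\<xi>, 1 :: nat))"

lemma push_\<alpha>_inverse:
  assumes "Poly_Mapping.keys c \<subseteq> cubes k \<Lambda> r"
  shows "push \<alpha>' (push \<alpha> c) = c" "push \<alpha> (push \<alpha>' c) = c"
  unfolding push_push
  by (rule push_id[OF assms]; simp add: cubes_def \<alpha>'_\<alpha> \<alpha>_\<alpha>')+

lemma keys_push_functor:
  assumes "degree_functor \<Lambda> \<phi>" "Poly_Mapping.keys c \<subseteq> cubes k \<Lambda> r"
  shows "Poly_Mapping.keys (push \<phi> c) \<subseteq> cubes k \<Lambda> r"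
  by (rule keys_push[OF assms(2) functor_cube(1)[OF assms(1)]])

lemma keys_base: "Poly_Mapping.keys c \<subseteq> cubes k \<Lambda> r \<Longrightarrow> Poly_Mapping.keys (base c) \<subseteq> cubes (k + 1) X r"
  by (erule keys_push) (simp only: cubes_X, simp)

lemma keys_prism: "Poly_Mapping.keys c \<subseteq> cubes k \<Lambda> r \<Longrightarrow> Poly_Mapping.keys (prism c) \<subseteq> cubes (k + 1) X (r + 1)"
  by (erule keys_push) (simp only: cubes_X, simp)

lemma push_functor_cycles:
  assumes "degree_functor \<Lambda> \<phi>" "z \<in> cycles k \<Lambda> r"
  shows "push \<phi> z \<in> cycles k \<Lambda> r"
  using assms keys_push_functor boundary_functor[of \<phi> z r] by (simp add: cycles_iff)

lemma push_functor_boundaries: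
  assumes "degree_functor \<Lambda> \<phi>" "b \<in> boundaries k \<Lambda> r"
  shows "push \<phi> b \<in> boundaries k \<Lambda> r"
  using assms(2) boundary_functor[OF assms(1)] keys_push_functor[OF assms(1)] unfolding boundaries_iff by metis

lemma base_cycles: "z \<in> cycles k \<Lambda> r \<Longrightarrow> base z \<in> cycles (k + 1) X r"
  unfolding cycles_iff using keys_base boundary_base by (metis frag_extend_0)

lemma base_boundaries: "b \<in> boundaries k \<Lambda> r \<Longrightarrow> base b \<in> boundaries (k + 1) X r"
  unfolding boundaries_iff using keys_base boundary_base by metis

lemma layer_decompose:
  "layer 1 (base a + prism b) = b" "layer 0 (base a + prism b) = a"
  by (simp_all add: layer_add layer_push)

lemma boundary_decompose:
  assumes "Poly_Mapping.keys a \<subseteq> cubes k \<Lambda> (r + 1)" "Poly_Mapping.keys b \<subseteq> cubes k \<Lambda> r"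
  shows "boundary (k + 1) X (r + 1) (base a + prism b) =
     base (boundary k \<Lambda> (r + 1) a + frag_cmul ((-1) ^ (r + 1)) (b - push \<alpha>' b)) + prism (boundary k \<Lambda> r b)"
  unfolding boundary_add boundary_base[OF assms(1)] boundary_prism[OF assms(2)]
    frag_extend_add frag_extend_cmul
  by (simp only: add_ac)

text \<open>The two components of the boundary vanish separately. Thus a cycle of the crossed product is a cycle
  \<open>b\<close> of \<open>\<Lambda>\<close> together with a chain \<open>a\<close> that makes \<open>b\<close> and \<open>\<alpha>\<inverse> b\<close> homologous.\<close>

lemma cycle_X_iff:
  assumes "Poly_Mapping.keys a \<subseteq> cubes k \<Lambda> (r + 1)" "Poly_Mapping.keys b \<subseteq> cubes k \<Lambda> r"
  shows "base a + prism b \<in> cycles (k + 1) X (r + 1) \<longleftrightarrow>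
    boundary k \<Lambda> (r + 1) a = frag_cmul ((-1) ^ r) (b - push \<alpha>' b) \<and> b \<in> cycles k \<Lambda> r"
proof -
  have zero: "base x + prism y = 0 \<longleftrightarrow> x = 0 \<and> y = 0" for x y :: "'a \<Rightarrow>\<^sub>0 int"
    using layer_decompose[of x y] by (auto simp: layer_zero)
  have "Poly_Mapping.keys (base a + prism b) \<subseteq> cubes (k + 1) X (r + 1)"
    by (rule keys_add_subset[OF keys_base[OF assms(1)] keys_prism[OF assms(2)]])
  then have "base a + prism b \<in> cycles (k + 1) X (r + 1) \<longleftrightarrow>
      boundary k \<Lambda> (r + 1) a + frag_cmul ((-1) ^ (r + 1)) (b - push \<alpha>' b) = 0 \<and> boundary k \<Lambda> r b = 0"
    unfolding cycles_iff boundary_decompose[OF assms] zero by blast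
  also have "frag_cmul ((-1) ^ (r + 1)) (b - push \<alpha>' b) = - frag_cmul ((-1) ^ r) (b - push \<alpha>' b)"
    by simp
  finally show ?thesis
    unfolding add_uminus_conv_diff right_minus_eq cycles_iff using assms(2) by blast
qed

lemma layer_cycles:
  assumes "c \<in> cycles (k + 1) X (r + 1)" shows "layer 1 c \<in> cycles k \<Lambda> r"
proof -
  have "Poly_Mapping.keys c \<subseteq> cubes (k + 1) X (r + 1)" using assms unfolding cycles_iff by blast
  then obtain a b where ab: "Poly_Mapping.keys a \<subseteq> cubes k \<Lambda> (r + 1)" "Poly_Mapping.keys b \<subseteq> cubes k \<Lambda> r"
    "c = base a + prism b" by (rule chain_X_decompose)
  show ?thesis
    using assms cycle_X_iff[OF ab(1,2)] unfolding ab(3) layer_decompose by blast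
qed

lemma layer_boundaries:
  assumes "c \<in> boundaries (k + 1) X (r + 1)" shows "layer 1 c \<in> boundaries k \<Lambda> r"
proof -
  obtain d where "Poly_Mapping.keys d \<subseteq> cubes (k + 1) X (r + 1 + 1)" and c: "c = boundary (k + 1) X (r + 1 + 1) d"
    using assms unfolding boundaries_iff by blast
  then obtain a b where ab: "Poly_Mapping.keys a \<subseteq> cubes k \<Lambda> (r + 1 + 1)" "Poly_Mapping.keys b \<subseteq> cubes k \<Lambda> (r + 1)"
    "d = base a + prism b" by (elim chain_X_decompose)
  show ?thesis
    unfolding c ab(3) boundary_decompose[OF ab(1,2)] layer_decompose boundaries_iff using ab(2) by blast
qed

abbreviation "cl \<equiv> homology_class k \<Lambda>"
abbreviation "clX \<equiv> homology_class (k + 1) X"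

lemma alpha_star_class: "alpha_star k \<Lambda> \<alpha> r (cl r z) = cl r (push \<alpha> z)"
  unfolding alpha_star_def
  by (rule homology_map_class) (simp_all add: frag_extend_add push_functor_boundaries[OF functor_\<alpha>])

lemma iota_star_class: "iota_star k \<Lambda> \<alpha> r (cl r z) = clX r (base z)"
  unfolding iota_star_def by (rule homology_map_class) (simp_all only: frag_extend_add base_boundaries)

lemma pi_star_class: "pi_star k \<Lambda> r (clX (r + 1) c) = cl r (frag_cmul ((-1) ^ r) (layer 1 c))"
  unfolding pi_star_eq
  by (rule homology_map_class) (simp_all only: layer_add frag_cmul_distrib2 layer_boundaries boundaries_closed(4))

lemma one_minus_alpha_star_class:
  assumes "z \<in> cycles k \<Lambda> r"
  shows "one_minus_alpha_star k \<Lambda> \<alpha> r (cl r z) = cl r (z - push \<alpha> z)"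
  unfolding one_minus_alpha_star_def alpha_star_class
  by (simp add: homology_inv homology_mult push_functor_cycles[OF functor_\<alpha> assms])

lemma hom_iota: "group_hom (homology k \<Lambda> r) (homology (k + 1) X r) (iota_star k \<Lambda> \<alpha> r)"
  by (rule group_hom_homologyI[OF k_graph_axioms X.k_graph_axioms, of base])
     (simp_all only: frag_extend_add base_cycles iota_star_class)

lemma hom_pi: "group_hom (homology (k + 1) X (r + 1)) (homology k \<Lambda> r) (pi_star k \<Lambda> r)"
  by (rule group_hom_homologyI[OF X.k_graph_axioms k_graph_axioms, of "\<lambda>c. frag_cmul ((-1) ^ r) (layer 1 c)"])
     (simp_all only: layer_add frag_cmul_distrib2 layer_cycles cycles_closed(4) pi_star_class)

lemma hom_one_minus_alpha:
  "group_hom (homology k \<Lambda> r) (homology k \<Lambda> r) (one_minus_alpha_star k \<Lambda> \<alpha> r)"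
  by (rule group_hom_homologyI[OF k_graph_axioms k_graph_axioms, of "\<lambda>z. z - push \<alpha> z"])
     (simp_all add: frag_extend_add one_minus_alpha_star_class cycles_closed(2) push_functor_cycles[OF functor_\<alpha>])

text \<open>Since \<open>1 - \<alpha>\<inverse> = -\<alpha>\<inverse> (1 - \<alpha>)\<close> and \<open>\<alpha>\<close> is invertible, the map \<open>1 - \<alpha>\<inverse>\<close> from the mapping cone and the
  map \<open>1 - \<alpha>\<close> of the exact sequence have the same kernel and the same image in homology.\<close>

lemma one_minus_swap:
  assumes "Poly_Mapping.keys c \<subseteq> cubes k \<Lambda> r"
  shows "push \<alpha> (c - push \<alpha>' c) = - (c - push \<alpha> c)" "push \<alpha>' (c - push \<alpha> c) = - (c - push \<alpha>' c)"
  using push_\<alpha>_inverse[OF assms] by (simp_all add: frag_extend_diff)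

text \<open>A class of \<open>\<Lambda>\<close> lifts to the crossed product if and only if its prism can be closed up by a chain in
  the base.\<close>

lemma exact_pi_one_minus_alpha:
  "exact_at (homology (k + 1) X (r + 1)) (pi_star k \<Lambda> r) (homology k \<Lambda> r)
     (one_minus_alpha_star k \<Lambda> \<alpha> r) (homology k \<Lambda> r)"
proof (rule exact_at_homologyI[OF X.k_graph_axioms k_graph_axioms k_graph_axioms hom_pi hom_one_minus_alpha
      pi_star_class one_minus_alpha_star_class])
  fix c assume c: "c \<in> cycles (k + 1) X (r + 1)"
  then have "Poly_Mapping.keys c \<subseteq> cubes (k + 1) X (r + 1)" unfolding cycles_iff by blast
  then obtain a b where ab: "Poly_Mapping.keys a \<subseteq> cubes k \<Lambda> (r + 1)" "Poly_Mapping.keys b \<subseteq> cubes k \<Lambda> r"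
    "c = base a + prism b" by (rule chain_X_decompose)
  have l: "layer 1 c = b" unfolding ab(3) layer_decompose ..
  then show "frag_cmul ((-1) ^ r) (layer 1 c) \<in> cycles k \<Lambda> r"
    using layer_cycles[OF c] cycles_closed(4) by blast
  have "boundary k \<Lambda> (r + 1) a = frag_cmul ((-1) ^ r) (b - push \<alpha>' b)"
    using c cycle_X_iff[OF ab(1,2)] unfolding ab(3) by blast
  then have "push \<alpha> (frag_cmul ((-1) ^ r) (b - push \<alpha>' b)) \<in> boundaries k \<Lambda> r"
    using push_functor_boundaries[OF functor_\<alpha>] ab(1) unfolding boundaries_iff by metis
  then have "- frag_cmul ((-1) ^ r) (b - push \<alpha> b) \<in> boundaries k \<Lambda> r"
    unfolding frag_extend_cmul one_minus_swap(1)[OF ab(2)] frag_cmul_minus .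
  then have "frag_cmul ((-1) ^ r) (b - push \<alpha> b) \<in> boundaries k \<Lambda> r"
    using boundaries_closed(3) by (metis minus_minus)
  then show "frag_cmul ((-1) ^ r) (layer 1 c) - push \<alpha> (frag_cmul ((-1) ^ r) (layer 1 c)) \<in> boundaries k \<Lambda> r"
    unfolding l frag_extend_cmul frag_cmul_diff .
next
  fix z assume z: "z \<in> cycles k \<Lambda> r" "z - push \<alpha> z \<in> boundaries k \<Lambda> r"
  then obtain a where a: "Poly_Mapping.keys a \<subseteq> cubes k \<Lambda> (r + 1)" "z - push \<alpha> z = boundary k \<Lambda> (r + 1) a"
    unfolding boundaries_iff by blast
  have zk: "Poly_Mapping.keys z \<subseteq> cubes k \<Lambda> r" using z(1) by (simp add: cycles_iff)
  \<comment> \<open>The sign of \<open>?b\<close> undoes the sign in \<open>\<pi>\<^sub>*\<close>, and \<open>?a\<close> translates the relation between \<open>z\<close> and \<open>\<alpha> z\<close> back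
    by \<open>\<alpha>\<inverse>\<close> to a relation between \<open>z\<close> and \<open>\<alpha>\<inverse> z\<close>.\<close>
  let ?a = "- push \<alpha>' a" and ?b = "frag_cmul ((-1) ^ r) z"
  have keys: "Poly_Mapping.keys ?a \<subseteq> cubes k \<Lambda> (r + 1)" "Poly_Mapping.keys ?b \<subseteq> cubes k \<Lambda> r"
    using keys_push_functor[OF functor_\<alpha>' a(1)] keys_cmul_subset[OF zk] by simp_all
  have "boundary k \<Lambda> (r + 1) ?a = z - push \<alpha>' z"
    unfolding boundary_minus boundary_functor[OF functor_\<alpha>' a(1)] a(2)[symmetric] one_minus_swap(2)[OF zk] by simp
  also have "\<dots> = frag_cmul ((-1) ^ r) (?b - push \<alpha>' ?b)"
    unfolding frag_extend_cmul frag_cmul_diff frag_cmul_cmul power_add[symmetric] by simp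
  finally have "base ?a + prism ?b \<in> cycles (k + 1) X (r + 1)"
    unfolding cycle_X_iff[OF keys] using cycles_closed(4)[OF z(1)] by blast
  moreover have "z - frag_cmul ((-1) ^ r) (layer 1 (base ?a + prism ?b)) = 0"
    unfolding layer_decompose frag_cmul_cmul power_add[symmetric] by simp
  ultimately show "\<exists>c\<in>cycles (k + 1) X (r + 1). z - frag_cmul ((-1) ^ r) (layer 1 c) \<in> boundaries k \<Lambda> r"
    using zero_boundaries by metis
qed

text \<open>A prism over \<open>\<alpha> z\<close> bounds the difference of \<open>z\<close> and \<open>\<alpha> z\<close>. Conversely, a chain with boundary in the base
  consists of a chain of the base and a prism over a cycle.\<close>

lemma exact_one_minus_alpha_iota:
  "exact_at (homology k \<Lambda> r) (one_minus_alpha_star k \<Lambda> \<alpha> r) (homology k \<Lambda> r)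
     (iota_star k \<Lambda> \<alpha> r) (homology (k + 1) X r)"
proof (rule exact_at_homologyI[OF k_graph_axioms k_graph_axioms X.k_graph_axioms hom_one_minus_alpha hom_iota
      one_minus_alpha_star_class iota_star_class])
  fix z assume z: "z \<in> cycles k \<Lambda> r"
  have az: "push \<alpha> z \<in> cycles k \<Lambda> r" by (rule push_functor_cycles[OF functor_\<alpha> z])
  show "z - push \<alpha> z \<in> cycles k \<Lambda> r" by (rule cycles_closed(2)[OF z az])
  have zk: "Poly_Mapping.keys z \<subseteq> cubes k \<Lambda> r" "Poly_Mapping.keys (push \<alpha> z) \<subseteq> cubes k \<Lambda> r" "boundary k \<Lambda> r (push \<alpha> z) = 0"
    using z az by (simp_all add: cycles_iff)
  let ?b = "frag_cmul ((-1) ^ r) (push \<alpha> z)"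
  have bk: "Poly_Mapping.keys ?b \<subseteq> cubes k \<Lambda> r" by (rule keys_cmul_subset[OF zk(2)])
  have "frag_cmul ((-1) ^ (r + 1)) (?b - push \<alpha>' ?b) = z - push \<alpha> z"
    unfolding frag_extend_cmul frag_cmul_diff frag_cmul_cmul power_add[symmetric] push_\<alpha>_inverse(1)[OF zk(1)]
    by simp
  moreover have "boundary k \<Lambda> r ?b = 0"
    by (simp only: boundary_cmul zk(3) frag_cmul_zero2)
  ultimately have "boundary (k + 1) X (r + 1) (prism ?b) = base (z - push \<alpha> z)"
    unfolding boundary_prism[OF bk] frag_extend_cmul[symmetric, of _ _ "_ - _"]
    by (simp only: frag_extend_0 add_0_left)
  then show "base (z - push \<alpha> z) \<in> boundaries (k + 1) X r"
    using keys_prism[OF bk] unfolding boundaries_iff by metis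
next
  fix z assume z: "z \<in> cycles k \<Lambda> r" "base z \<in> boundaries (k + 1) X r"
  then obtain d where "Poly_Mapping.keys d \<subseteq> cubes (k + 1) X (r + 1)" and d: "base z = boundary (k + 1) X (r + 1) d"
    unfolding boundaries_iff by blast
  then obtain a b where ab: "Poly_Mapping.keys a \<subseteq> cubes k \<Lambda> (r + 1)" "Poly_Mapping.keys b \<subseteq> cubes k \<Lambda> r"
    "d = base a + prism b" by (elim chain_X_decompose)
  \<comment> \<open>The summand 0 puts both sides into the shape whose two layers can be compared.\<close>
  have "base z + prism 0 = base (boundary k \<Lambda> (r + 1) a + frag_cmul ((-1) ^ (r + 1)) (b - push \<alpha>' b)) + prism (boundary k \<Lambda> r b)"
    using d unfolding ab(3) boundary_decompose[OF ab(1,2)] by simp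
  then have e: "z = boundary k \<Lambda> (r + 1) a + frag_cmul ((-1) ^ (r + 1)) (b - push \<alpha>' b)" "boundary k \<Lambda> r b = 0"
    using layer_decompose by metis+
  let ?w = "frag_cmul ((-1) ^ r) (push \<alpha>' b)"
  have b': "push \<alpha>' b \<in> cycles k \<Lambda> r"
    by (rule push_functor_cycles[OF functor_\<alpha>']) (use e ab in \<open>simp add: cycles_iff\<close>)
  have "?w - push \<alpha> ?w = frag_cmul ((-1) ^ r) (- (b - push \<alpha>' b))"
    unfolding frag_extend_cmul push_\<alpha>_inverse(2)[OF ab(2)] frag_cmul_diff[symmetric] by simp
  also have "\<dots> = frag_cmul ((-1) ^ (r + 1)) (b - push \<alpha>' b)"
    by (rule poly_mapping_eqI) (simp add: lookup_minus right_diff_distrib)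
  finally have "z - (?w - push \<alpha> ?w) = boundary k \<Lambda> (r + 1) a" using e(1) by simp
  then have "z - (?w - push \<alpha> ?w) \<in> boundaries k \<Lambda> r" using ab(1) unfolding boundaries_iff by blast
  then show "\<exists>w\<in>cycles k \<Lambda> r. z - (w - push \<alpha> w) \<in> boundaries k \<Lambda> r"
    using cycles_closed(4)[OF b'] by blast
qed

text \<open>If the prism part \<open>b\<close> of a cycle is the boundary of \<open>b'\<close>, then subtracting the boundary of the prism
  over \<open>b'\<close> pushes the cycle into the base.\<close>

lemma exact_iota_pi:
  "exact_at (homology k \<Lambda> (r + 1)) (iota_star k \<Lambda> \<alpha> (r + 1)) (homology (k + 1) X (r + 1))
     (pi_star k \<Lambda> r) (homology k \<Lambda> r)"
proof (rule exact_at_homologyI[OF k_graph_axioms X.k_graph_axioms k_graph_axioms hom_iota hom_pi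
      iota_star_class pi_star_class base_cycles])
  fix z
  show "frag_cmul ((-1) ^ r) (layer 1 (base z)) \<in> boundaries k \<Lambda> r"
    by (simp add: layer_push)
next
  fix c assume c: "c \<in> cycles (k + 1) X (r + 1)" "frag_cmul ((-1) ^ r) (layer 1 c) \<in> boundaries k \<Lambda> r"
  then have "Poly_Mapping.keys c \<subseteq> cubes (k + 1) X (r + 1)" unfolding cycles_iff by blast
  then obtain a b where ab: "Poly_Mapping.keys a \<subseteq> cubes k \<Lambda> (r + 1)" "Poly_Mapping.keys b \<subseteq> cubes k \<Lambda> r"
    "c = base a + prism b" by (rule chain_X_decompose)
  have "frag_cmul ((-1) ^ r) (frag_cmul ((-1) ^ r) b) \<in> boundaries k \<Lambda> r"
    using boundaries_closed(4)[OF c(2)] unfolding ab(3) layer_decompose .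
  then have "b \<in> boundaries k \<Lambda> r" by (simp flip: power_add)
  then obtain b' where b': "Poly_Mapping.keys b' \<subseteq> cubes k \<Lambda> (r + 1)" "b = boundary k \<Lambda> (r + 1) b'"
    unfolding boundaries_iff by blast
  let ?s = "frag_cmul ((-1) ^ (r + 1 + 1)) (b' - push \<alpha>' b')"
  have bd: "base ?s + prism b = boundary (k + 1) X (r + 1 + 1) (prism b')"
    using boundary_prism[OF b'(1)] b'(2) by (simp add: frag_extend_cmul add.commute)
  then have B: "base ?s + prism b \<in> boundaries (k + 1) X (r + 1)"
    using keys_prism[OF b'(1)] unfolding boundaries_iff by metis
  have sk: "Poly_Mapping.keys ?s \<subseteq> cubes k \<Lambda> (r + 1)"
    by (rule keys_cmul_subset[OF keys_diff_subset[OF b'(1) keys_push_functor[OF functor_\<alpha>' b'(1)]]])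
  have diff: "c - (base ?s + prism b) = base (a - ?s)" unfolding ab(3) by (simp only: frag_extend_diff) simp
  have "base (a - ?s) \<in> cycles (k + 1) X (r + 1)"
    unfolding diff[symmetric] by (rule cycles_closed(2)[OF c(1) subsetD[OF X.boundaries_subset_cycles B]])
  then have "base (boundary k \<Lambda> (r + 1) (a - ?s)) = 0"
    using boundary_base[OF keys_diff_subset[OF ab(1) sk]] unfolding cycles_iff by simp
  then have "boundary k \<Lambda> (r + 1) (a - ?s) = 0"
    using layer_push[of 0 0 "boundary k \<Lambda> (r + 1) (a - ?s)"] by (simp add: layer_zero)
  then have w: "a - ?s \<in> cycles k \<Lambda> (r + 1)"
    using keys_diff_subset[OF ab(1) sk] by (simp add: cycles_iff)
  have "c - (c - (base ?s + prism b)) \<in> boundaries (k + 1) X (r + 1)"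
    using B by (simp only: diff_diff_eq2 add_diff_cancel_left')
  then have "c - base (a - ?s) \<in> boundaries (k + 1) X (r + 1)" unfolding diff .
  with w show "\<exists>w\<in>cycles k \<Lambda> (r + 1). c - base w \<in> boundaries (k + 1) X (r + 1)" by blast
qed

lemma cubes_above_dimension: "cubes k \<Lambda> (k + 1) = {}"
proof -
  have "card (dirs \<Lambda> \<xi>) \<noteq> k + 1" if "\<xi> \<in> arrows \<Lambda>" for \<xi>
    using card_mono[OF _ dirs_subset[OF that]] by simp
  then have "\<xi> \<notin> cubes k \<Lambda> (k + 1)" for \<xi> unfolding cubes_iff by blast
  then show ?thesis by blast
qed

text \<open>The sequence could be continued to the left by \<open>H\<^bsub>k+1\<^esub>(\<Lambda>)\<close>, which vanishes for lack of cubes; so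
  \<open>exact_iota_pi\<close> makes \<open>\<pi>\<^sub>*\<close> injective here.\<close>

lemma exact_zero_pi:
  "exact_at zero_group (\<lambda>_. \<one>\<^bsub>homology (k + 1) X (k + 1)\<^esub>) (homology (k + 1) X (k + 1)) (pi_star k \<Lambda> k) (homology k \<Lambda> k)"
proof -
  have cyc: "cycles k \<Lambda> (k + 1) = {0}"
    by (auto simp: cycles_iff cubes_above_dimension boundary_zero simp del: One_nat_def add_Suc_right)
  have "carrier (homology k \<Lambda> (k + 1)) = {cl (k + 1) 0}"
    unfolding homology_carrier cyc by simp
  then have "kernel (homology (k + 1) X (k + 1)) (homology k \<Lambda> k) (pi_star k \<Lambda> k) = {clX (k + 1) (base 0)}"
    using exact_iota_pi[of k] unfolding exact_at_def iota_star_class[symmetric] by auto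
  then show ?thesis
    using hom_pi group_hom_zero(1)[OF X.homology_group] unfolding exact_at_def X.homology_one by simp
qed

lemma exact_iota_zero:
  "exact_at (homology k \<Lambda> 0) (iota_star k \<Lambda> \<alpha> 0) (homology (k + 1) X 0) (\<lambda>_. ()) zero_group"
proof -
  have "x \<in> iota_star k \<Lambda> \<alpha> 0 ` carrier (homology k \<Lambda> 0)" if x: "x \<in> carrier (homology (k + 1) X 0)" for x
  proof -
    obtain c where c: "c \<in> cycles (k + 1) X 0" "x = clX 0 c"
      using x unfolding X.homology_carrier by blast
    then have "Poly_Mapping.keys c \<subseteq> cubes (k + 1) X 0" unfolding cycles_iff by blast
    then obtain a where a: "Poly_Mapping.keys a \<subseteq> cubes k \<Lambda> 0" "c = base a" by (rule chain_X_0_decompose)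
    have "boundary k \<Lambda> 0 a = 0" by (simp add: boundary_def frag_extend_eq_0)
    then have "a \<in> cycles k \<Lambda> 0" using a(1) unfolding cycles_iff by blast
    then have "cl 0 a \<in> carrier (homology k \<Lambda> 0)" unfolding homology_carrier by (rule imageI)
    then show ?thesis unfolding c(2) a(2) iota_star_class[symmetric] by (rule imageI)
  qed
  moreover have "iota_star k \<Lambda> \<alpha> 0 ` carrier (homology k \<Lambda> 0) \<subseteq> carrier (homology (k + 1) X 0)"
    by (intro image_subsetI group_hom.hom_closed[OF hom_iota])
  ultimately have "iota_star k \<Lambda> \<alpha> 0 ` carrier (homology k \<Lambda> 0) = carrier (homology (k + 1) X 0)"
    by blast
  moreover have "kernel (homology (k + 1) X 0) zero_group (\<lambda>_. ()) = carrier (homology (k + 1) X 0)"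
    unfolding kernel_def singleton_group_def by simp
  ultimately show ?thesis
    unfolding exact_at_def using hom_iota[of 0] group_hom_zero(2)[OF X.homology_group] by blast
qed

end

theorem theorem4p13:
  fixes k :: nat and \<Lambda> :: "'a kgraph_data" and \<alpha> :: "'a \<Rightarrow> 'a"
  assumes "k_graph k \<Lambda>"
    and "kgraph_automorphism \<Lambda> \<alpha>"
  shows
    "let H = homology k \<Lambda>;
         HX = homology (k + 1) (crossed_product k \<Lambda> \<alpha>);
         \<pi> = pi_star k \<Lambda>;
         \<delta> = one_minus_alpha_star k \<Lambda> \<alpha>;
         \<iota> = iota_star k \<Lambda> \<alpha>
     in exact_at zero_group (\<lambda>_. \<one>\<^bsub>HX (k + 1)\<^esub>) (HX (k + 1)) (\<pi> k) (H k)
      \<and> (\<forall>r\<le>k. exact_at (HX (r + 1)) (\<pi> r) (H r) (\<delta> r) (H r))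
      \<and> (\<forall>r\<le>k. exact_at (H r) (\<delta> r) (H r) (\<iota> r) (HX r))
      \<and> (\<forall>r<k. exact_at (H (r + 1)) (\<iota> (r + 1)) (HX (r + 1)) (\<pi> r) (H r))
      \<and> exact_at (H 0) (\<iota> 0) (HX 0) (\<lambda>_. ()) zero_group"
proof -
  interpret k_graph_automorphism k \<Lambda> \<alpha>
    using assms by (intro k_graph_automorphism.intro k_graph_automorphism_axioms.intro)
  show ?thesis
    unfolding Let_def
    by (intro conjI allI impI exact_zero_pi exact_pi_one_minus_alpha exact_one_minus_alpha_iota
        exact_iota_pi exact_iota_zero)
qed

end
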